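(* Let $\Gamma=(G,\sigma)$ be a connected signed graph of order $n\ge 2$ with cyclomatic number $\beta(\Gamma)=|E(\Gamma)|-|V(\Gamma)|+1$, and let $\eta(\Gamma)$ denote the nullity of its net Laplacian matrix $L^{\pm}(\Gamma)$. Then: (i) $1\le \eta(\Gamma)\le \min\{\beta(\Gamma)+1,\ n-1\}$. (ii) $\eta(\Gamma)=n-1$ if and only if $n$ is even and $\Gamma=K_{n/2}\triangledown^{-}K_{n/2}$ or $\Gamma=-(K_{n/2}\triangledown^{-}K_{n/2})$. Moreover, if $\Gamma$ is a signed cactus graph, then (iii) $\eta(\Gamma)=1$ if and only if $m^+(C)\neq m^-(C)$ for every cycle $C$ of $\Gamma$; (iv) $\eta(\Gamma)=\beta(\Gamma)+1$ if and only if $m^+(C)=m^-(C)$ for every cycle $C$ of $\Gamma$.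
   Context: A signed graph $\Gamma=(G,\sigma)$ consists of a simple graph $G$ (the underlying graph) and a sign function $\sigma:E(G)\to\{-1,+1\}$. For a vertex $v$, $d^+(v)$ (resp. $d^-(v)$) is the number of neighbours joined to $v$ by a positive (resp. negative) edge, and the net-degree is $d^{\pm}(v)=d^+(v)-d^-(v)$. The adjacency matrix $A(\Gamma)$ has entry $\sigma(uv)$ if $u,v$ are adjacent and $0$ otherwise; the net Laplacian matrix is $L^{\pm}(\Gamma)=D^{\pm}(\Gamma)-A(\Gamma)$, where $D^{\pm}(\Gamma)$ is the diagonal matrix of net-degrees. The nullity $\eta(\Gamma)$ is the multiplicity of $0$ as an eigenvalue of $L^{\pm}(\Gamma)$. $-\Gamma$ denotes the signed graph obtained by reversing the sign of every edge. $K_{n/2}$ denotes the complete graph on $n/2$ vertices with all edges positive, and $K_{n/2}\triangledown^{-}K_{n/2}$ is the signed complete graph on $n$ vertices obtained from two disjoint copies of this $K_{n/2}$ by adding all negative edges between the vertices of one copy and those of the other. A cactus graph is a connected graph in which any two cycles share no edge; a signed cactus graph is a signed graph whose underlying graph is a cactus graph. For a cycle $C$, $m^+(C)$ and $m^-(C)$ are the numbers of positive and negative edges of $C$. *)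

theory Defs
  imports "Jordan_Normal_Form.Char_Poly"
begin

text \<open>
  Edges are two-element sets of vertices.  Only the values of the sign function on edges matter.
\<close>

record 'a sgraph =
  verts :: "'a set"
  edges :: "'a set set"
  sigma :: "'a set \<Rightarrow> int"

definition signed_graph :: "'a sgraph \<Rightarrow> bool" where
  "signed_graph \<Gamma> \<longleftrightarrow>
     finite (verts \<Gamma>) \<and>
     (\<forall>e\<in>edges \<Gamma>. e \<subseteq> verts \<Gamma> \<and> card e = 2) \<and>
     (\<forall>e\<in>edges \<Gamma>. sigma \<Gamma> e \<in> {-1, 1})"

definition connected_sgraph :: "'a sgraph \<Rightarrow> bool" where
  "connected_sgraph \<Gamma> \<longleftrightarrow>
     verts \<Gamma> \<noteq> {} \<and>
     (\<forall>u\<in>verts \<Gamma>. \<forall>v\<in>verts \<Gamma>. (u, v) \<in> {(x, y). {x, y} \<in> edges \<Gamma>}\<^sup>*)"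

definition cyclomatic :: "'a sgraph \<Rightarrow> int" where
  "cyclomatic \<Gamma> = int (card (edges \<Gamma>)) - int (card (verts \<Gamma>)) + 1"

definition pos_degree :: "'a sgraph \<Rightarrow> 'a \<Rightarrow> nat" where
  "pos_degree \<Gamma> v = card {u \<in> verts \<Gamma>. {u, v} \<in> edges \<Gamma> \<and> sigma \<Gamma> {u, v} = 1}"

definition neg_degree :: "'a sgraph \<Rightarrow> 'a \<Rightarrow> nat" where
  "neg_degree \<Gamma> v = card {u \<in> verts \<Gamma>. {u, v} \<in> edges \<Gamma> \<and> sigma \<Gamma> {u, v} = -1}"

definition net_degree :: "'a sgraph \<Rightarrow> 'a \<Rightarrow> int" where
  "net_degree \<Gamma> v = int (pos_degree \<Gamma> v) - int (neg_degree \<Gamma> v)"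

text \<open>
  The matrices are indexed by natural numbers, so they are taken with respect to an
  enumeration \<open>vs\<close> of the vertices.
\<close>

definition vertex_enum :: "'a sgraph \<Rightarrow> 'a list \<Rightarrow> bool" where
  "vertex_enum \<Gamma> vs \<longleftrightarrow> distinct vs \<and> set vs = verts \<Gamma>"

definition adj_matrix :: "'a sgraph \<Rightarrow> 'a list \<Rightarrow> real mat" where
  "adj_matrix \<Gamma> vs = mat (length vs) (length vs)
     (\<lambda>(i, j). if {vs ! i, vs ! j} \<in> edges \<Gamma> then real_of_int (sigma \<Gamma> {vs ! i, vs ! j}) else 0)"

definition net_degree_matrix :: "'a sgraph \<Rightarrow> 'a list \<Rightarrow> real mat" where
  "net_degree_matrix \<Gamma> vs = mat (length vs) (length vs)
     (\<lambda>(i, j). if i = j then real_of_int (net_degree \<Gamma> (vs ! i)) else 0)"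

definition net_laplacian :: "'a sgraph \<Rightarrow> 'a list \<Rightarrow> real mat" where
  "net_laplacian \<Gamma> vs = net_degree_matrix \<Gamma> vs - adj_matrix \<Gamma> vs"

definition nullity :: "'a sgraph \<Rightarrow> 'a list \<Rightarrow> nat" where
  "nullity \<Gamma> vs = Polynomial.order 0 (char_poly (net_laplacian \<Gamma> vs))"

definition neg_sgraph :: "'a sgraph \<Rightarrow> 'a sgraph" where
  "neg_sgraph \<Gamma> = \<Gamma>\<lparr>sigma := (\<lambda>e. - sigma \<Gamma> e)\<rparr>"

definition complete_sgraph :: "nat \<Rightarrow> nat sgraph" where
  "complete_sgraph k = \<lparr>verts = {..<k}, edges = {e. e \<subseteq> {..<k} \<and> card e = 2}, sigma = (\<lambda>_. 1)\<rparr>"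

text \<open>The disjoint union of two signed graphs, together with all negative edges between them.\<close>

definition neg_join :: "'a sgraph \<Rightarrow> 'b sgraph \<Rightarrow> ('a + 'b) sgraph" where
  "neg_join \<Gamma>\<^sub>1 \<Gamma>\<^sub>2 =
     \<lparr>verts = verts \<Gamma>\<^sub>1 <+> verts \<Gamma>\<^sub>2,
      edges = (\<lambda>e. Inl ` e) ` edges \<Gamma>\<^sub>1 \<union> (\<lambda>e. Inr ` e) ` edges \<Gamma>\<^sub>2 \<union>
              {{Inl u, Inr v} | u v. u \<in> verts \<Gamma>\<^sub>1 \<and> v \<in> verts \<Gamma>\<^sub>2},
      sigma = (\<lambda>e. if e \<subseteq> range Inl then sigma \<Gamma>\<^sub>1 (Inl -` e)
                   else if e \<subseteq> range Inr then sigma \<Gamma>\<^sub>2 (Inr -` e)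
                   else -1)\<rparr>"

definition sgraph_iso :: "'a sgraph \<Rightarrow> 'b sgraph \<Rightarrow> bool" where
  "sgraph_iso \<Gamma> \<Gamma>' \<longleftrightarrow>
     (\<exists>f. bij_betw f (verts \<Gamma>) (verts \<Gamma>') \<and>
          edges \<Gamma>' = (\<lambda>e. f ` e) ` edges \<Gamma> \<and>
          (\<forall>e\<in>edges \<Gamma>. sigma \<Gamma>' (f ` e) = sigma \<Gamma> e))"

text \<open>
  A cycle is a subgraph, hence it is identified with its set of edges: the different vertex lists
  obtained by rotating or reversing the traversal represent the same cycle.
\<close>

definition cycle_list :: "'a sgraph \<Rightarrow> 'a list \<Rightarrow> bool" where
  "cycle_list \<Gamma> c \<longleftrightarrow>
     length c \<ge> 3 \<and> distinct c \<and>
     (\<forall>i<length c. {c ! i, c ! (Suc i mod length c)} \<in> edges \<Gamma>)"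

definition cycles :: "'a sgraph \<Rightarrow> 'a set set set" where
  "cycles \<Gamma> = {{{c ! i, c ! (Suc i mod length c)} | i. i < length c} | c. cycle_list \<Gamma> c}"

definition signed_cactus :: "'a sgraph \<Rightarrow> bool" where
  "signed_cactus \<Gamma> \<longleftrightarrow>
     signed_graph \<Gamma> \<and> connected_sgraph \<Gamma> \<and>
     (\<forall>C\<in>cycles \<Gamma>. \<forall>C'\<in>cycles \<Gamma>. C \<noteq> C' \<longrightarrow> C \<inter> C' = {})"

definition m_pos :: "'a sgraph \<Rightarrow> 'a set set \<Rightarrow> nat" where
  "m_pos \<Gamma> C = card {e \<in> C. sigma \<Gamma> e = 1}"

definition m_neg :: "'a sgraph \<Rightarrow> 'a set set \<Rightarrow> nat" where
  "m_neg \<Gamma> C = card {e \<in> C. sigma \<Gamma> e = -1}"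

end

(*
  Orient the edges and let B be the incidence map from edge functions to vertex functions, so that
  the net Laplacian is L = B S B^T with S the diagonal matrix of signs.  If L x = 0, then
  f = S B^T x is a flow (B f = 0), and f is S-orthogonal to every flow g because
  <S f, g> = <B^T x, g> = <x, B g> = 0.  Conversely an edge function orthogonal to all flows is a
  gradient.  As the kernel of B^T consists of the constants, the nullity of L exceeds by one the
  dimension of the radical of the form <S f, g> on the flow space, whose dimension is the cyclomatic
  number.  Flows are spanned by the +-1 vectors of cycles; in a cactus these have disjoint supports,
  so the form is diagonal with entries m_pos C - m_neg C.

  If the nullity is n - 1, the columns of L are proportional.  Symmetry, integrality and
  connectedness then force all entries to be 1 or -1, so L = c x x^T with c = 1 or c = -1 and x a
  balanced vector of signs.
*)
theory Submission
  imports Defs "HOL-Library.Function_Algebras"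
begin

section \<open>Finite-dimensional subspaces of function spaces\<close>

text \<open>The net Laplacian is symmetric but indefinite: for a kernel vector \<open>x\<close> the
  vanishing of x^T L x does not force the gradient of \<open>x\<close> to vanish. This is why the
  nullity is governed by a radical and can exceed 1 on a connected graph. \<open>nullity\<close> is
  an algebraic multiplicity, whereas the flow argument computes the dimension of a kernel. Symmetry
  makes the two agree; this is shown by an identity of determinants over polynomials instead of a
  diagonalisation. Both upper bounds compare nested finite-dimensional subspaces, the radical inside
  the flow space and the kernel inside the space of all vertex functions. Strict inclusion lowers
  the dimension, so an equality of dimensions becomes an equality of subspaces. When the nullity is
  n - 1, all 2x2 minors vanish. Hence no entry of L is 0, the graph is complete, and L_uu L_vv =
  L_uv^2 = 1. The diagonal entries are integers, so each of them is 1 or -1.\<close>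

definition fscale :: "real \<Rightarrow> ('b \<Rightarrow> real) \<Rightarrow> 'b \<Rightarrow> real" where
  "fscale c f = (\<lambda>x. c * f x)"

lemma fscale_apply [simp]: "fscale c f x = c * f x"
  by (simp add: fscale_def)

lemma sum_fun_apply: "(\<Sum>i\<in>I. f i) x = (\<Sum>i\<in>I. (f i x :: real))"
  by (induction I rule: infinite_finite_induct) auto

text \<open>Vertices and edges form sets inside types that may be infinite, so the ambient function
  space need not be finite-dimensional. For this reason the dimension lemmas below carry an explicit
  finite spanning set \<open>B\<close>.\<close>

interpretation fs: vector_space fscale
  by unfold_locales (auto simp: fun_eq_iff algebra_simps)

interpretation fsp: vector_space_pair fscale fscale ..

text \<open>The coordinates of \<open>x\<close> with respect to \<open>D\<close> vanish outside
  \<open>C\<close> and also outside \<open>D - C\<close>, hence everywhere.\<close>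

lemma (in vector_space) independent_span_disjoint:
  assumes "independent D" "C \<subseteq> D" "x \<in> span C" "x \<in> span (D - C)"
  shows "x = 0"
proof -
  have x: "x \<in> span D"
    using assms(2,3) span_mono by blast
  have "representation D x = representation C x"
    using assms by (intro representation_extend)
  moreover have "representation D x = representation (D - C) x"
    using assms by (intro representation_extend) auto
  ultimately have "representation D x b = 0" for b
    using representation_ne_zero[of C x b] representation_ne_zero[of "D - C" x b] by auto
  then show ?thesis
    using sum_nonzero_representation_eq[OF assms(1) x] by simp
qed

text \<open>A basis \<open>C\<close> of the kernel part is extended to a basis \<open>D\<close> of
  \<open>S\<close>. On the span of \<open>D - C\<close> the map is injective, and the images of
  \<open>D - C\<close> form a basis of the image.\<close>

lemma (in vector_space_pair) rank_nullity:
  assumes lin: "Vector_Spaces.linear s1 s2 f" and S: "vs1.subspace S" "S \<subseteq> vs1.span B" "finite B"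
  shows "vs1.dim S = vs1.dim (S \<inter> {x. f x = 0}) + vs2.dim (f ` S)"
proof -
  interpret f: Vector_Spaces.linear s1 s2 f by fact
  define K where "K = S \<inter> {x. f x = 0}"
  obtain C where C: "C \<subseteq> K" "vs1.independent C" "K \<subseteq> vs1.span C" "card C = vs1.dim K"
    using vs1.basis_exists[of K] by blast
  have "C \<subseteq> S" using C K_def by blast
  then obtain D where D: "C \<subseteq> D" "D \<subseteq> S" "vs1.independent D" "S \<subseteq> vs1.span D"
    using vs1.maximal_independent_subset_extend[of C S] C by metis
  have finD: "finite D"
    using vs1.independent_span_bound[OF S(3) D(3)] D(2) S(2) by blast
  have card: "card D = card C + card (D - C)"
    using finD D(1) by (metis card_Diff_subset card_mono finite_subset le_add_diff_inverse)
  have inj: "inj_on f (vs1.span (D - C))"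
  proof (subst f.inj_on_iff_eq_0)
    show "vs1.subspace (vs1.span (D - C))" by simp
    show "\<forall>x\<in>vs1.span (D - C). f x = 0 \<longrightarrow> x = 0"
    proof (intro ballI impI)
      fix x assume x: "x \<in> vs1.span (D - C)" "f x = 0"
      have "vs1.span (D - C) \<subseteq> S"
        using D S(1) by (intro vs1.span_minimal) auto
      then have "x \<in> vs1.span C"
        using x C(3) K_def by blast
      then show "x = 0"
        using vs1.independent_span_disjoint[OF D(3,1)] x by blast
    qed
  qed
  have ind: "vs2.independent (f ` (D - C))"
    using f.independent_injective_image[OF _ inj] vs1.independent_mono[OF D(3)] by blast
  have "f ` S \<subseteq> vs2.span (f ` (D - C))"
  proof -
    have "f ` D \<subseteq> vs2.span (f ` (D - C))"
    proof
      fix y assume "y \<in> f ` D"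
      then obtain d where d: "d \<in> D" "y = f d" by blast
      show "y \<in> vs2.span (f ` (D - C))"
      proof (cases "d \<in> C")
        case True
        then have "y = 0" using C(1) d K_def by auto
        then show ?thesis by (simp add: vs2.span_zero)
      next
        case False
        then show ?thesis using d by (simp add: vs2.span_base)
      qed
    qed
    then have "vs2.span (f ` D) \<subseteq> vs2.span (f ` (D - C))"
      by (intro vs2.span_minimal) auto
    then show ?thesis using D(4) f.span_image[of D] by blast
  qed
  moreover have "f ` (D - C) \<subseteq> f ` S" using D by blast
  ultimately have "vs2.dim (f ` S) = card (f ` (D - C))"
    using ind vs2.basis_card_eq_dim by metis
  also have "\<dots> = card (D - C)"
    by (intro card_image inj_on_subset[OF inj] vs1.span_superset)
  finally have "vs2.dim (f ` S) = card (D - C)" .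
  moreover have "vs1.dim S = card D"
    using D vs1.basis_card_eq_dim by metis
  ultimately show ?thesis
    using card C(4) K_def by simp
qed

context vector_space
begin

text \<open>If a basis of \<open>S\<close> extended to a basis of \<open>T\<close> without growing,
  its span would contain \<open>T\<close> and lie inside \<open>S\<close>. The strict inequality
  later turns extremal dimensions into equalities of subspaces.\<close>

lemma subspace_dim_psubset:
  assumes "subspace S" "S \<subset> T" "T \<subseteq> span B" "finite B"
  shows "dim S < dim T"
proof -
  obtain C where C: "C \<subseteq> S" "independent C" "S \<subseteq> span C" "card C = dim S"
    using basis_exists[of S] by blast
  have "C \<subseteq> T" using C assms by blast
  then obtain D where D: "C \<subseteq> D" "D \<subseteq> T" "independent D" "T \<subseteq> span D"
    using maximal_independent_subset_extend[of C T] C by metis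
  have finD: "finite D"
    using independent_span_bound[OF assms(4) D(3)] D(2) assms(3) by blast
  have "C \<noteq> D"
  proof
    assume "C = D"
    have "span C \<subseteq> S" using C(1) assms(1) span_minimal by blast
    then show False using \<open>C = D\<close> D(4) assms(2) by blast
  qed
  then have "card C < card D" using D(1) finD psubset_card_mono by blast
  moreover have "dim T = card D"
    using D basis_card_eq_dim by metis
  ultimately show ?thesis using C(4) by simp
qed

lemma subspace_dim_mono:
  assumes "subspace S" "S \<subseteq> T" "T \<subseteq> span B" "finite B"
  shows "dim S \<le> dim T"
proof (cases "S = T")
  case False
  then show ?thesis using subspace_dim_psubset[of S T B] assms by (simp add: psubset_eq)
qed simp

end

text \<open>Functions on \<open>S\<close>, extended by zero: fixing the values outside
  \<open>S\<close> gives each function on \<open>S\<close> exactly one representative, so that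
  dimensions count correctly.\<close>

definition supported :: "'b set \<Rightarrow> ('b \<Rightarrow> real) set" where
  "supported S = {f. \<forall>x. x \<notin> S \<longrightarrow> f x = 0}"

definition delta :: "'b \<Rightarrow> 'b \<Rightarrow> real" where
  "delta a = (\<lambda>x. of_bool (x = a))"

lemma subspace_supported: "fs.subspace (supported S)"
  by (auto simp: supported_def fs.subspace_def)

lemma delta_in_supported: "a \<in> S \<Longrightarrow> delta a \<in> supported S"
  by (auto simp: supported_def delta_def)

lemma inj_delta: "inj_on delta S"
proof (rule inj_onI)
  fix x y :: 'b assume "delta x = delta y"
  then have "delta x x = delta y x" by simp
  then show "x = y" by (simp add: delta_def split: if_splits)
qed

lemma supported_expand:
  assumes "finite S" "f \<in> supported S"
  shows "f = (\<Sum>a\<in>S. fscale (f a) (delta a))"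
proof
  fix x
  have "(\<Sum>a\<in>S. f a * delta a x) = (\<Sum>a\<in>S. if a = x then f x else 0)"
    by (intro sum.cong) (auto simp: delta_def)
  then show "f x = (\<Sum>a\<in>S. fscale (f a) (delta a)) x"
    using assms by (auto simp: sum_fun_apply supported_def sum.delta')
qed

lemma independent_delta:
  assumes "finite S"
  shows "fs.independent (delta ` S)"
proof (rule fs.independent_if_scalars_zero)
  show "finite (delta ` S)" using assms by simp
  fix c x assume *: "(\<Sum>x\<in>delta ` S. fscale (c x) x) = 0" "x \<in> delta ` S"
  then obtain a where a: "a \<in> S" "x = delta a" by blast
  have "0 = (\<Sum>x\<in>delta ` S. fscale (c x) x) a" using * by simp
  also have "\<dots> = (\<Sum>b\<in>S. c (delta b) * delta b a)"
    by (simp add: sum_fun_apply sum.reindex[OF inj_delta])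
  also have "\<dots> = (\<Sum>b\<in>S. if b = a then c (delta a) else 0)"
    by (intro sum.cong) (auto simp: delta_def)
  also have "\<dots> = c x" using a assms by simp
  finally show "c x = 0" by simp
qed

lemma supported_subset_span:
  assumes "finite S"
  shows "supported S \<subseteq> fs.span (delta ` S)"
proof
  fix f assume "f \<in> supported S"
  then have "f = (\<Sum>a\<in>S. fscale (f a) (delta a))" using supported_expand[OF assms] by blast
  moreover have "(\<Sum>a\<in>S. fscale (f a) (delta a)) \<in> fs.span (delta ` S)"
    by (intro fs.span_sum fs.span_scale fs.span_base) simp
  ultimately show "f \<in> fs.span (delta ` S)" by metis
qed

lemma dim_supported:
  assumes "finite S"
  shows "fs.dim (supported S) = card S"
proof (rule fs.dim_unique)
  show "delta ` S \<subseteq> supported S" by (intro image_subsetI delta_in_supported)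
  show "supported S \<subseteq> fs.span (delta ` S)" using assms by (rule supported_subset_span)
  show "fs.independent (delta ` S)" using assms by (rule independent_delta)
  show "card (delta ` S) = card S" by (intro card_image inj_delta)
qed

section \<open>The kernel of a symmetric matrix\<close>

text \<open>Rows and columns are indexed by the elements of \<open>S\<close> themselves, so this
  kernel does not depend on an enumeration of the vertices.\<close>

definition mat_fun_kernel :: "'a set \<Rightarrow> ('a \<Rightarrow> 'a \<Rightarrow> real) \<Rightarrow> ('a \<Rightarrow> real) set" where
  "mat_fun_kernel S a = {x \<in> supported S. \<forall>u\<in>S. (\<Sum>v\<in>S. a u v * x v) = 0}"

lemma subspace_mat_fun_kernel: "fs.subspace (mat_fun_kernel S a)"
  by (auto simp: mat_fun_kernel_def fs.subspace_def supported_def algebra_simps sum.distrib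
      simp flip: sum_distrib_left)

lemma det_poly_eval: "det (map_mat (\<lambda>q. poly q t) A) = poly (det A) (t :: real)"
proof -
  have "comm_ring_hom (\<lambda>q. poly q t)" by unfold_locales auto
  then show ?thesis by (rule comm_ring_hom.hom_det)
qed

lemma char_poly_times_det:
  fixes A P Q X :: "real poly mat"
  assumes "A \<in> carrier_mat n n" "P \<in> carrier_mat n n" "Q \<in> carrier_mat n n" "X \<in> carrier_mat n n"
    and "A * P = Q * X"
  shows "det A * det P = det Q * det X"
  using assms by (metis det_mult)

text \<open>This is the passage from algebraic to geometric multiplicity of the eigenvalue 0. It
  relies on symmetry: a nilpotent Jordan block has a kernel smaller than the multiplicity.\<close>

lemma order_char_poly_symmetric:
  fixes a :: "'a \<Rightarrow> 'a \<Rightarrow> real"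
  assumes dist: "distinct vs" and S: "set vs = S"
    and sym: "\<And>u v. u \<in> S \<Longrightarrow> v \<in> S \<Longrightarrow> a u v = a v u"
    and A: "A = mat (length vs) (length vs) (\<lambda>(i, j). a (vs ! i) (vs ! j))"
  shows "Polynomial.order 0 (char_poly A) = fs.dim (mat_fun_kernel S a)"
proof -
  define n where "n = length vs"
  have finS: "finite S" using S by auto
  have cardS: "card S = n" using S dist n_def distinct_card by auto
  define K where "K = mat_fun_kernel S a"
  have KS: "K \<subseteq> supported S" by (auto simp: K_def mat_fun_kernel_def)
  have sum_S: "(\<Sum>i<n. g (vs ! i)) = (\<Sum>v\<in>S. g v)" for g :: "'a \<Rightarrow> real"
    using sum.reindex_bij_betw[OF bij_betw_nth[OF dist refl refl]] by (simp add: n_def S)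
  have vs_in: "vs ! i \<in> S" if "i < n" for i using that S n_def by auto
  obtain B where B: "B \<subseteq> K" "fs.independent B" "K \<subseteq> fs.span B" "card B = fs.dim K"
    using fs.basis_exists[of K] by blast
  obtain D where D: "B \<subseteq> D" "D \<subseteq> supported S" "fs.independent D" "supported S \<subseteq> fs.span D"
    using fs.maximal_independent_subset_extend[of B "supported S"] B KS by (metis order_trans)
  have finD: "finite D"
    using fs.independent_span_bound[of "delta ` S" D] finS D(2,3) supported_subset_span[OF finS] by auto
  have finB: "finite B" using D(1) finD finite_subset by blast
  have cardD: "card D = n"
    using D fs.basis_card_eq_dim dim_supported[OF finS] cardS by metis
  define k where "k = card B"
  obtain bs where bs: "distinct bs" "set bs = B" using finite_distinct_list[OF finB] by blast
  obtain ds where ds: "distinct ds" "set ds = D - B" using finite_distinct_list[of "D - B"] finD by blast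
  \<comment> \<open>The basis is listed with the kernel vectors first, at the positions below
    \<open>k\<close>.\<close>
  define p where "p = (\<lambda>j. (bs @ ds) ! j)"
  have len_bs: "length bs = k" using bs k_def distinct_card by fastforce
  have dist_ps: "distinct (bs @ ds)" "set (bs @ ds) = D" using bs ds D(1) by auto
  have len: "length (bs @ ds) = n" using dist_ps cardD distinct_card by metis
  have kn: "k \<le> n" using len len_bs by simp
  have bij: "bij_betw p {..<n} D"
    using bij_betw_nth[OF dist_ps(1) _ dist_ps(2)[symmetric]] len unfolding p_def by blast
  have pB: "p j \<in> B" if "j < k" for j
    using that bs len_bs by (auto simp: p_def nth_append)
  have pD: "p j \<in> D - B" if "k \<le> j" "j < n" for j
    using that ds len len_bs nth_mem[of "j - k" ds] by (auto simp: p_def nth_append)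
  have p_supp: "p j \<in> supported S" if "j < n" for j
    using bij that D(2) by (auto simp: bij_betw_def)
  have p_ker: "(\<Sum>v\<in>S. a u v * p j v) = 0" if "j < k" "u \<in> S" for j u
    using pB[OF that(1)] B(1) that(2) by (auto simp: K_def mat_fun_kernel_def)
  \<comment> \<open>\<open>xI - A\<close> maps a kernel column \<open>p\<close> of \<open>P\<close> to \<open>x p\<close>; pulling out these factors \<open>x\<close> into \<open>X\<close> leaves \<open>Q\<close>,
    and \<open>Q(0)\<close> is invertible because the kernel and the image of a symmetric matrix are orthogonal.\<close>
  define P :: "real poly mat" where "P = mat n n (\<lambda>(i, j). [:p j (vs ! i):])"
  define Q :: "real poly mat" where "Q = mat n n (\<lambda>(i, j). if j < k then [:p j (vs ! i):]
      else [:- (\<Sum>v\<in>S. a (vs ! i) v * p j v), p j (vs ! i):])"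
  define X :: "real poly mat" where
    "X = mat n n (\<lambda>(i, j). if i = j then if i < k then [:0, 1:] else 1 else 0)"
  have carr: "char_poly_matrix A \<in> carrier_mat n n" "P \<in> carrier_mat n n"
    "Q \<in> carrier_mat n n" "X \<in> carrier_mat n n"
    by (auto simp: A n_def P_def Q_def X_def)
  have "char_poly_matrix A * P = Q * X"
  proof (rule eq_matI)
    fix i j assume "i < dim_row (Q * X)" "j < dim_col (Q * X)"
    then have ij: "i < n" "j < n" by (auto simp: Q_def X_def)
    have "poly ((char_poly_matrix A * P) $$ (i, j)) t = poly ((Q * X) $$ (i, j)) t" for t
    proof -
      have "poly ((char_poly_matrix A * P) $$ (i, j)) t
          = (\<Sum>l<n. (t * of_bool (i = l) - a (vs ! i) (vs ! l)) * p j (vs ! l))"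
        using ij by (auto simp: char_poly_matrix_def P_def A n_def[symmetric] scalar_prod_def poly_sum
            atLeast0LessThan algebra_simps intro!: sum.cong)
      also have "\<dots> = (\<Sum>l<n. if i = l then t * p j (vs ! l) else 0) - (\<Sum>l<n. a (vs ! i) (vs ! l) * p j (vs ! l))"
        unfolding sum_subtractf[symmetric] by (intro sum.cong) (auto simp: algebra_simps)
      also have "\<dots> = t * p j (vs ! i) - (\<Sum>v\<in>S. a (vs ! i) v * p j v)"
        using ij sum_S[of "\<lambda>v. a (vs ! i) v * p j v"] by simp
      finally have 1: "poly ((char_poly_matrix A * P) $$ (i, j)) t = \<dots>" .
      have "poly ((Q * X) $$ (i, j)) t = (\<Sum>l<n. poly (Q $$ (i, l)) t * poly (X $$ (l, j)) t)"
        using ij carr by (auto simp: scalar_prod_def poly_sum atLeast0LessThan intro!: sum.cong)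
      also have "\<dots> = (\<Sum>l<n. if l = j then poly (Q $$ (i, j)) t * poly (X $$ (j, j)) t else 0)"
        using ij by (intro sum.cong) (auto simp: X_def)
      also have "\<dots> = poly (Q $$ (i, j)) t * poly (X $$ (j, j)) t" using ij by simp
      also have "\<dots> = t * p j (vs ! i) - (\<Sum>v\<in>S. a (vs ! i) v * p j v)"
        using ij p_ker[of j "vs ! i"] vs_in[of i] by (auto simp: X_def Q_def)
      finally show ?thesis using 1 by simp
    qed
    then show "(char_poly_matrix A * P) $$ (i, j) = (Q * X) $$ (i, j)"
      by (auto simp flip: poly_eq_poly_eq_iff)
  qed (use carr in auto)
  then have eq: "char_poly A * det P = det Q * det X"
    unfolding char_poly_def using char_poly_times_det carr by blast
  have "det X = (\<Prod>i<n. if i < k then [:0, 1:] else 1)"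
  proof -
    have "upper_triangular X" by (rule upper_triangularI) (auto simp: X_def)
    then have "det X = prod_list (diag_mat X)"
      using carr(4) det_upper_triangular by blast
    also have "\<dots> = (\<Prod>i<n. if i < k then [:0, 1:] else 1)"
      by (auto simp: prod_list_diag_prod X_def atLeast0LessThan intro!: prod.cong)
    finally show ?thesis .
  qed
  also have "\<dots> = [:0, 1:] ^ k"
  proof -
    have "{..<n} \<inter> {i. i < k} = {..<k}" using kn by auto
    then show ?thesis by (simp add: prod.If_cases)
  qed
  finally have detX: "det X = [:0, 1:] ^ k" .
  have Q0: "poly (det Q) 0 \<noteq> 0"
  proof
    define Q0 where "Q0 = map_mat (\<lambda>q. poly q 0) Q"
    have Q0c: "Q0 \<in> carrier_mat n n" using carr by (simp add: Q0_def)
    assume "poly (det Q) 0 = 0"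
    then have "det Q0 = 0" by (simp add: Q0_def det_poly_eval)
    then obtain c where c: "c \<in> carrier_vec n" "c \<noteq> 0\<^sub>v n" "Q0 *\<^sub>v c = 0\<^sub>v n"
      using det_0_iff_vec_prod_zero[OF Q0c] by blast
    \<comment> \<open>A vanishing combination of the columns of \<open>Q0\<close> is split into its
      kernel part \<open>y\<close> and its complementary part \<open>w\<close>. Since the later
      columns of \<open>Q\<close> at 0 are the negated images under \<open>a\<close>, the relation
      says that \<open>y\<close> is the image of \<open>w\<close>.\<close>
    define y where "y = (\<Sum>j<k. fscale (c $ j) (p j))"
    define w where "w = (\<Sum>j\<in>{k..<n}. fscale (c $ j) (p j))"
    have yB: "y \<in> fs.span B" unfolding y_def
      using pB by (intro fs.span_sum fs.span_scale fs.span_base) auto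
    have wD: "w \<in> fs.span (D - B)" unfolding w_def
      using pD by (intro fs.span_sum fs.span_scale fs.span_base) auto
    have spanBK: "fs.span B \<subseteq> K"
      using B(1) subspace_mat_fun_kernel K_def by (intro fs.span_minimal) auto
    have yK: "y \<in> K" using yB spanBK by blast
    have "fs.span (D - B) \<subseteq> supported S"
      using D(2) by (intro fs.span_minimal subspace_supported) auto
    then have wS: "w \<in> supported S" using wD by blast
    have yw: "y u = (\<Sum>v\<in>S. a u v * w v)" if u: "u \<in> S" for u
    proof -
      obtain i where i: "i < n" "u = vs ! i" using u S by (metis in_set_conv_nth n_def)
      have "0 = (Q0 *\<^sub>v c) $ i" using c(3) i by simp
      also have "\<dots> = (\<Sum>j<n. Q0 $$ (i, j) * c $ j)"
        using i c(1) Q0c by (auto simp: scalar_prod_def atLeast0LessThan)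
      also have "\<dots> = (\<Sum>j<k. Q0 $$ (i, j) * c $ j) + (\<Sum>j\<in>{k..<n}. Q0 $$ (i, j) * c $ j)"
        by (rule sum.atLeastLessThan_concat[OF le0 kn, symmetric, unfolded atLeast0LessThan])
      also have "(\<Sum>j<k. Q0 $$ (i, j) * c $ j) = y u"
        using i kn unfolding y_def sum_fun_apply by (intro sum.cong) (auto simp: Q0_def Q_def)
      also have "(\<Sum>j\<in>{k..<n}. Q0 $$ (i, j) * c $ j) = (\<Sum>j\<in>{k..<n}. \<Sum>v\<in>S. - (a u v * (c $ j * p j v)))"
        using i by (intro sum.cong) (auto simp: Q0_def Q_def sum_distrib_left algebra_simps sum_negf)
      also have "\<dots> = - (\<Sum>v\<in>S. a u v * w v)"
        unfolding w_def sum_fun_apply sum_negf sum_distrib_left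
        by (subst sum.swap) simp
      finally show ?thesis by simp
    qed
    \<comment> \<open>Symmetry moves the matrix from \<open>w\<close> to \<open>y\<close>, where it
      gives 0. So \<open>y\<close> vanishes; then \<open>w\<close> is a kernel vector in the span of
      the complement of the kernel basis, and vanishes too.\<close>
    have "(\<Sum>u\<in>S. (y u)\<^sup>2) = (\<Sum>u\<in>S. \<Sum>v\<in>S. y u * (a u v * w v))"
      using yw by (intro sum.cong) (auto simp: power2_eq_square sum_distrib_left)
    also have "\<dots> = (\<Sum>v\<in>S. \<Sum>u\<in>S. w v * (a v u * y u))"
      using sym by (subst sum.swap) (auto simp: algebra_simps intro!: sum.cong)
    also have "\<dots> = (\<Sum>v\<in>S. w v * (\<Sum>u\<in>S. a v u * y u))"
      by (simp add: sum_distrib_left)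
    also have "\<dots> = 0"
      using yK by (intro sum.neutral) (auto simp: K_def mat_fun_kernel_def)
    finally have y0: "y u = 0" if "u \<in> S" for u
      using that finS by (simp add: sum_nonneg_eq_0_iff)
    then have "w \<in> K" using yw wS by (auto simp: K_def mat_fun_kernel_def)
    then have w0: "w = 0"
      using fs.independent_span_disjoint[OF D(3,1) _ wD] B(3) by blast
    have "y x = 0" for x
      using y0[of x] yK KS by (cases "x \<in> S") (auto simp: supported_def)
    then have "y = 0" by auto
    with w0 have "0 = (\<Sum>j<k. fscale (c $ j) (p j)) + (\<Sum>j\<in>{k..<n}. fscale (c $ j) (p j))"
      by (simp add: y_def w_def)
    also have "\<dots> = (\<Sum>j<n. fscale (c $ j) (p j))"
      by (rule sum.atLeastLessThan_concat[OF le0 kn, unfolded atLeast0LessThan])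
    also have "\<dots> = (\<Sum>j<n. fscale (c $ (inv_into {..<n} p (p j))) (p j))"
      using bij by (intro sum.cong) (auto simp: bij_betw_def)
    also have "\<dots> = (\<Sum>d\<in>D. fscale (c $ (inv_into {..<n} p d)) d)"
      by (rule sum.reindex_bij_betw[OF bij])
    finally have *: "(\<Sum>d\<in>D. fscale (c $ (inv_into {..<n} p d)) d) = 0" by simp
    have "c $ j = 0" if "j < n" for j
      using fs.independentD[OF D(3) finD order_refl *, of "p j"] that bij by (auto simp: bij_betw_def)
    then have "c = 0\<^sub>v n" using c(1) by (intro eq_vecI) auto
    then show False using c(2) by simp
  qed
  then have "det Q \<noteq> 0" by auto
  have oX: "Polynomial.order 0 ([:0, 1:] ^ k :: real poly) = k"
    using order_power_n_n[of "0::real" k] by simp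
  have nz: "det Q * det X \<noteq> 0" using \<open>det Q \<noteq> 0\<close> detX by simp
  \<comment> \<open>The entries of \<open>P\<close> are constants, hence so is its determinant. It
    is nonzero because the right-hand side of \<open>eq\<close> is, and therefore contributes
    nothing to the order at 0.\<close>
  have "poly (det P) t = poly (det P) 0" for t
  proof -
    have "map_mat (\<lambda>q. poly q t) P = map_mat (\<lambda>q. poly q 0) P"
      by (auto simp: P_def)
    then show ?thesis by (metis det_poly_eval)
  qed
  then have "poly (det P) 0 \<noteq> 0"
    using nz eq by (metis mult_zero_right poly_0 poly_eq_poly_eq_iff ext)
  then have "Polynomial.order 0 (det P) = 0" by (rule order_0I)
  moreover have "Polynomial.order 0 (det Q) = 0" using Q0 by (rule order_0I)
  moreover have "Polynomial.order 0 (char_poly A * det P) = Polynomial.order 0 (char_poly A) + Polynomial.order 0 (det P)"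
    using nz eq by (metis order_mult)
  moreover have "Polynomial.order 0 (det Q * det X) = Polynomial.order 0 (det Q) + Polynomial.order 0 (det X)"
    using nz by (rule order_mult)
  ultimately have "Polynomial.order 0 (char_poly A) = k"
    using eq detX oX by simp
  then show ?thesis using k_def B(4) K_def by simp
qed

section \<open>Gradients, flows and the net Laplacian\<close>

lemma fs_linearI:
  assumes "\<And>x y. f (x + y) = f x + f y" "\<And>c x. f (fscale c x) = fscale c (f x)"
  shows "Vector_Spaces.linear fscale fscale f"
  unfolding Vector_Spaces.linear_iff
  using assms by (auto intro: fs.vector_space_axioms)

text \<open>Rank-nullity for the functional with coefficients \<open>w\<close>. Its values are
  placed on the line spanned by \<open>delta r\<close>, because \<open>fsp\<close> treats maps from
  function spaces to function spaces.\<close>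

lemma dim_hyperplane:
  assumes S: "finite S" "r \<in> S" "w r \<noteq> 0"
  shows "Suc (fs.dim {x \<in> supported S. (\<Sum>v\<in>S. w v * x v) = 0}) = card S"
proof -
  define f where "f = (\<lambda>x. fscale (\<Sum>v\<in>S. w v * x v) (delta r))"
  have lin: "Vector_Spaces.linear fscale fscale f"
    by (rule fs_linearI) (auto simp: f_def fun_eq_iff algebra_simps sum.distrib sum_distrib_left)
  have "f ` supported S = supported {r}"
  proof (intro equalityI subsetI)
    fix y assume y: "y \<in> supported {r}"
    define x where "x = fscale (y r / w r) (delta r)"
    have "(\<Sum>v\<in>S. w v * x v) = (\<Sum>v\<in>S. if v = r then y r else 0)"
      using S(3) by (intro sum.cong) (auto simp: x_def delta_def)
    then have "f x = y"
      using S y by (auto simp: f_def fun_eq_iff delta_def supported_def)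
    moreover have "x \<in> supported S" using S by (auto simp: x_def supported_def delta_def)
    ultimately show "y \<in> f ` supported S" by blast
  qed (auto simp: f_def supported_def delta_def)
  moreover have "supported S \<inter> {x. f x = 0} = {x \<in> supported S. (\<Sum>v\<in>S. w v * x v) = 0}"
    by (auto simp: f_def fun_eq_iff delta_def)
  ultimately have "fs.dim (supported S) = fs.dim {x \<in> supported S. (\<Sum>v\<in>S. w v * x v) = 0} + fs.dim (supported {r})"
    using fsp.rank_nullity[OF lin subspace_supported supported_subset_span[OF S(1)]] S(1) by auto
  then show ?thesis using dim_supported[of "{r}"] dim_supported[OF S(1)] by simp
qed

locale conn_signed_graph =
  fixes \<Gamma> :: "'a sgraph"
  assumes signed: "signed_graph \<Gamma>" and connected: "connected_sgraph \<Gamma>"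
begin

abbreviation "V \<equiv> verts \<Gamma>"
abbreviation "E \<equiv> edges \<Gamma>"
abbreviation "sg e \<equiv> real_of_int (sigma \<Gamma> e)"

lemma finite_V: "finite V"
  using signed by (simp add: signed_graph_def)

lemma edge_subset: "e \<in> E \<Longrightarrow> e \<subseteq> V"
  using signed by (simp add: signed_graph_def)

lemma finite_E: "finite E"
  by (rule finite_subset[of _ "Pow V"]) (use edge_subset finite_V in auto)

lemma sigma_cases: "e \<in> E \<Longrightarrow> sigma \<Gamma> e = 1 \<or> sigma \<Gamma> e = -1"
  using signed by (auto simp: signed_graph_def)

lemma sg_sq: "e \<in> E \<Longrightarrow> sg e * sg e = 1"
  using sigma_cases[of e] by auto

lemma edge_ne: "{u, v} \<in> E \<Longrightarrow> u \<noteq> v"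
  using signed by (auto simp: signed_graph_def)

text \<open>An arbitrary orientation. Reversing an edge negates its incidence column, and the
  Laplacian contains only products of two entries of the same column.\<close>

definition tail :: "'a set \<Rightarrow> 'a" where "tail e = (SOME v. v \<in> e)"
definition head :: "'a set \<Rightarrow> 'a" where "head e = (SOME v. v \<in> e \<and> v \<noteq> tail e)"

lemma edge_ends:
  assumes "e \<in> E"
  shows "e = {tail e, head e}" "tail e \<noteq> head e"
proof -
  obtain x y where xy: "e = {x, y}" "x \<noteq> y"
    using assms signed by (auto simp: signed_graph_def card_2_iff)
  have "\<exists>v. v \<in> e" using xy by auto
  then have t: "tail e \<in> e" unfolding tail_def by (rule someI_ex)
  have "x \<in> e" "y \<in> e" using xy(1) by auto
  then have "\<exists>v. v \<in> e \<and> v \<noteq> tail e" using xy(2) by metis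
  then have h: "head e \<in> e \<and> head e \<noteq> tail e" unfolding head_def by (rule someI_ex)
  have *: "e = {a, b}" if "a \<in> e" "b \<in> e" "b \<noteq> a" for a b using that xy by auto
  show "e = {tail e, head e}" by (rule *) (use t h in simp_all)
  show "tail e \<noteq> head e" using h by metis
qed

lemma ends_eq_iff:
  assumes "e \<in> E"
  shows "e = {u, v} \<longleftrightarrow> u = tail e \<and> v = head e \<or> u = head e \<and> v = tail e"
proof -
  have "{tail e, head e} = {u, v} \<longleftrightarrow> u = tail e \<and> v = head e \<or> u = head e \<and> v = tail e"
    by (auto simp: doubleton_eq_iff)
  then show ?thesis unfolding edge_ends(1)[OF assms, symmetric] .
qed

lemma ends_of_pair:
  assumes "{u, v} \<in> E"
  shows "tail {u, v} = u \<and> head {u, v} = v \<or> tail {u, v} = v \<and> head {u, v} = u"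
proof -
  have "u = tail {u, v} \<and> v = head {u, v} \<or> u = head {u, v} \<and> v = tail {u, v}"
    by (rule iffD1[OF ends_eq_iff[OF assms]]) (rule refl)
  then show ?thesis by (elim disjE conjE) (blast intro: sym)+
qed

lemma mem_edge_iff:
  assumes "e \<in> E"
  shows "v \<in> e \<longleftrightarrow> v = tail e \<or> v = head e"
proof -
  have "v \<in> {tail e, head e} \<longleftrightarrow> v = tail e \<or> v = head e" by simp
  then show ?thesis unfolding edge_ends(1)[OF assms, symmetric] .
qed

lemma ends_in_V: "e \<in> E \<Longrightarrow> tail e \<in> V \<and> head e \<in> V"
  using edge_subset[of e] mem_edge_iff[of e "tail e"] mem_edge_iff[of e "head e"] by auto

section \<open>Boundary, gradient and the signed form on edge functions\<close>

definition inc :: "'a set \<Rightarrow> 'a \<Rightarrow> real" where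
  "inc e v = of_bool (v = head e) - of_bool (v = tail e)"

text \<open>\<open>bdry\<close> is the map B of the overview, \<open>grad\<close> its transpose and
  \<open>twist\<close> the diagonal matrix S.\<close>

definition bdry :: "('a set \<Rightarrow> real) \<Rightarrow> 'a \<Rightarrow> real" where
  "bdry f v = (\<Sum>e\<in>E. f e * inc e v)"

definition grad :: "('a \<Rightarrow> real) \<Rightarrow> 'a set \<Rightarrow> real" where
  "grad x e = (if e \<in> E then x (head e) - x (tail e) else 0)"

definition twist :: "('a set \<Rightarrow> real) \<Rightarrow> 'a set \<Rightarrow> real" where
  "twist f e = sg e * f e"

definition sform :: "('a set \<Rightarrow> real) \<Rightarrow> ('a set \<Rightarrow> real) \<Rightarrow> real" where
  "sform f g = (\<Sum>e\<in>E. sg e * f e * g e)"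

definition flows :: "('a set \<Rightarrow> real) set" where
  "flows = {f \<in> supported E. bdry f = 0}"

definition sform_radical :: "('a set \<Rightarrow> real) set" where
  "sform_radical = {f \<in> flows. \<forall>g\<in>flows. sform f g = 0}"

definition lap :: "'a \<Rightarrow> 'a \<Rightarrow> real" where
  "lap u v = (if u = v then real_of_int (net_degree \<Gamma> u) else 0) -
             (if {u, v} \<in> E then sg {u, v} else 0)"

lemma bdry_add: "bdry (f + g) = bdry f + bdry g"
  by (auto simp: bdry_def fun_eq_iff algebra_simps sum.distrib)

lemma bdry_fscale: "bdry (fscale c f) = fscale c (bdry f)"
  by (auto simp: bdry_def fun_eq_iff algebra_simps sum_distrib_left)

lemma bdry_zero: "bdry 0 = 0"
  by (auto simp: bdry_def fun_eq_iff)

lemma bdry_diff: "bdry (f - g) = bdry f - bdry g"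
  by (auto simp: bdry_def fun_eq_iff algebra_simps sum_subtractf)

lemma linear_bdry: "Vector_Spaces.linear fscale fscale bdry"
  by (rule fs_linearI) (auto simp: bdry_add bdry_fscale)

lemma subspace_flows: "fs.subspace flows"
  using subspace_supported[of E]
  by (auto simp: fs.subspace_def flows_def bdry_add bdry_fscale bdry_zero fun_eq_iff)

lemma sform_add: "sform (f + g) h = sform f h + sform g h"
  "sform h (f + g) = sform h f + sform h g"
  by (auto simp: sform_def algebra_simps sum.distrib)

lemma sform_fscale: "sform (fscale c f) h = c * sform f h" "sform h (fscale c f) = c * sform h f"
  by (auto simp: sform_def algebra_simps sum_distrib_left)

lemma sform_diff: "sform h (f - g) = sform h f - sform h g"
  by (simp add: sform_def algebra_simps sum_subtractf)

lemma sform_zero: "sform 0 h = 0" "sform h 0 = 0"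
  by (auto simp: sform_def)

lemma subspace_radical: "fs.subspace sform_radical"
  using subspace_flows
  by (auto simp: fs.subspace_def sform_radical_def sform_add sform_fscale sform_zero)

lemma bdry_outside: "v \<notin> V \<Longrightarrow> bdry f v = 0"
  unfolding bdry_def using ends_in_V by (intro sum.neutral) (auto simp: inc_def)

lemma sum_inc: "e \<in> E \<Longrightarrow> (\<Sum>v\<in>V. inc e v * x v) = x (head e) - x (tail e)"
proof -
  assume e: "e \<in> E"
  have "(\<Sum>v\<in>V. inc e v * x v) = (\<Sum>v\<in>V. if v = head e then x (head e) else 0) - (\<Sum>v\<in>V. if v = tail e then x (tail e) else 0)"
    unfolding sum_subtractf[symmetric] by (intro sum.cong) (auto simp: inc_def)
  then show ?thesis using ends_in_V[OF e] finite_V by simp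
qed

text \<open>Summation by parts: gradient and boundary are adjoint to each other.\<close>

lemma sum_grad: "(\<Sum>e\<in>E. f e * grad x e) = (\<Sum>v\<in>V. bdry f v * x v)"
proof -
  have "(\<Sum>e\<in>E. f e * grad x e) = (\<Sum>e\<in>E. f e * (\<Sum>v\<in>V. inc e v * x v))"
    by (intro sum.cong) (auto simp: grad_def sum_inc)
  also have "\<dots> = (\<Sum>v\<in>V. \<Sum>e\<in>E. f e * (inc e v * x v))"
    by (subst sum.swap) (simp add: sum_distrib_left)
  also have "\<dots> = (\<Sum>v\<in>V. bdry f v * x v)"
    by (simp add: bdry_def sum_distrib_right mult.assoc)
  finally show ?thesis .
qed

lemma inc_mult_ne:
  assumes "e \<in> E" "u \<noteq> v"
  shows "inc e u * inc e v = - of_bool (e = {u, v})"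
  using edge_ends(2)[OF assms(1)] assms(2) by (auto simp: inc_def ends_eq_iff[OF assms(1)])

lemma inc_mult_same:
  assumes "e \<in> E"
  shows "inc e u * inc e u = of_bool (u \<in> e)"
  using edge_ends(2)[OF assms(1)] by (auto simp: inc_def mem_edge_iff[OF assms(1)])

text \<open>Degrees count neighbours while the sum runs over incident edges; a neighbour
  \<open>w\<close> corresponds to the edge \<open>{w, u}\<close>.\<close>

lemma net_degree_eq_sum: "real_of_int (net_degree \<Gamma> u) = (\<Sum>e\<in>E. sg e * of_bool (u \<in> e))"
proof -
  define N where "N = {w \<in> V. {w, u} \<in> E}"
  have finN: "finite N" using finite_V N_def by simp
  have bij: "bij_betw (\<lambda>w. {w, u}) N {e \<in> E. u \<in> e}"
  proof (rule bij_betwI')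
    fix x y assume "x \<in> N" "y \<in> N"
    then show "({x, u} = {y, u}) = (x = y)" by (auto simp: doubleton_eq_iff)
  next
    fix e assume e: "e \<in> {e \<in> E. u \<in> e}"
    then have "e = {tail e, u} \<or> e = {head e, u}"
      using ends_eq_iff[of e] mem_edge_iff[of e u] by blast
    then obtain w where "e = {w, u}" by blast
    then show "\<exists>w\<in>N. e = {w, u}" using e edge_subset[of e] by (auto simp: N_def)
  qed (auto simp: N_def)
  have "(\<Sum>e\<in>E. sg e * of_bool (u \<in> e)) = (\<Sum>e\<in>{e \<in> E. u \<in> e}. sg e)"
    using finite_E by (intro sum.mono_neutral_cong_right) auto
  also have "\<dots> = (\<Sum>w\<in>N. sg {w, u})"
    by (rule sum.reindex_bij_betw[OF bij, symmetric])
  also have "\<dots> = (\<Sum>w\<in>N. of_bool (sigma \<Gamma> {w, u} = 1) - of_bool (sigma \<Gamma> {w, u} = -1))"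
    using sigma_cases by (intro sum.cong) (force simp: N_def)+
  also have "\<dots> = real (card (N \<inter> {w. sigma \<Gamma> {w, u} = 1})) - real (card (N \<inter> {w. sigma \<Gamma> {w, u} = -1}))"
    using finN by (simp add: sum_subtractf sum.If_cases of_bool_def)
  also have "N \<inter> {w. sigma \<Gamma> {w, u} = 1} = {w \<in> V. {w, u} \<in> E \<and> sigma \<Gamma> {w, u} = 1}"
    by (auto simp: N_def)
  also have "N \<inter> {w. sigma \<Gamma> {w, u} = -1} = {w \<in> V. {w, u} \<in> E \<and> sigma \<Gamma> {w, u} = -1}"
    by (auto simp: N_def)
  finally show ?thesis by (simp add: net_degree_def pos_degree_def neg_degree_def)
qed

text \<open>The factorisation L = B S B^T, entry by entry. On the diagonal each incident edge
  contributes its sign; off the diagonal only the edge joining the two vertices contributes, with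
  the opposite sign.\<close>

lemma lap_eq_sum: "lap u v = (\<Sum>e\<in>E. sg e * (inc e u * inc e v))"
proof (cases "u = v")
  case True
  have "(\<Sum>e\<in>E. sg e * (inc e u * inc e u)) = (\<Sum>e\<in>E. sg e * of_bool (u \<in> e))"
    by (intro sum.cong) (auto simp: inc_mult_same)
  then show ?thesis using True net_degree_eq_sum[of u] edge_ne[of u u] by (auto simp: lap_def)
next
  case False
  have "(\<Sum>e\<in>E. sg e * (inc e u * inc e v)) = (\<Sum>e\<in>E. if e = {u, v} then - sg {u, v} else 0)"
    using False by (intro sum.cong) (auto simp: inc_mult_ne)
  then show ?thesis using False finite_E by (auto simp: lap_def)
qed

lemma lap_apply: "(\<Sum>v\<in>V. lap u v * x v) = bdry (twist (grad x)) u"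
proof -
  have "(\<Sum>v\<in>V. lap u v * x v) = (\<Sum>v\<in>V. \<Sum>e\<in>E. sg e * inc e u * (inc e v * x v))"
    by (simp add: lap_eq_sum sum_distrib_right sum_distrib_left algebra_simps)
  also have "\<dots> = (\<Sum>e\<in>E. sg e * inc e u * (\<Sum>v\<in>V. inc e v * x v))"
    by (subst sum.swap) (simp add: sum_distrib_left)
  also have "\<dots> = bdry (twist (grad x)) u"
    unfolding bdry_def by (intro sum.cong) (auto simp: twist_def grad_def sum_inc)
  finally show ?thesis .
qed

abbreviation "lap_kernel \<equiv> mat_fun_kernel V lap"

lemma lap_kernel_iff: "x \<in> lap_kernel \<longleftrightarrow> x \<in> supported V \<and> bdry (twist (grad x)) = 0"
  using bdry_outside by (auto simp: mat_fun_kernel_def lap_apply fun_eq_iff)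

lemma nullity_eq_dim:
  assumes "vertex_enum \<Gamma> vs"
  shows "nullity \<Gamma> vs = fs.dim lap_kernel"
proof -
  have vs: "distinct vs" "set vs = V" using assms by (auto simp: vertex_enum_def)
  have "net_laplacian \<Gamma> vs = mat (length vs) (length vs) (\<lambda>(i, j). lap (vs ! i) (vs ! j))"
    using vs(1) by (intro eq_matI)
      (auto simp: net_laplacian_def net_degree_matrix_def adj_matrix_def lap_def nth_eq_iff_index_eq)
  moreover have "lap u v = lap v u" for u v by (simp add: lap_eq_sum algebra_simps)
  ultimately show ?thesis
    unfolding nullity_def by (intro order_char_poly_symmetric[OF vs])
qed

text \<open>One unit of flow travelling from \<open>u\<close> to \<open>v\<close>; the sign
  compensates for the arbitrary orientation of the edge.\<close>

definition edge_unit :: "'a \<Rightarrow> 'a \<Rightarrow> 'a set \<Rightarrow> real" where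
  "edge_unit u v e = (if e = {u, v} then if v = head e then 1 else -1 else 0)"

lemma edge_unit_supported: "{u, v} \<in> E \<Longrightarrow> edge_unit u v \<in> supported E"
  by (auto simp: supported_def edge_unit_def)

lemma bdry_edge_unit:
  assumes "{u, v} \<in> E"
  shows "bdry (edge_unit u v) = delta v - delta u"
proof
  fix w
  have "bdry (edge_unit u v) w = (\<Sum>e\<in>E. if e = {u, v} then edge_unit u v {u, v} * inc {u, v} w else 0)"
    unfolding bdry_def by (intro sum.cong) (auto simp: edge_unit_def)
  also have "\<dots> = edge_unit u v {u, v} * inc {u, v} w" using assms finite_E by simp
  also have "\<dots> = delta v w - delta u w"
    using ends_of_pair[OF assms] edge_ne[OF assms] by (auto simp: edge_unit_def inc_def delta_def)
  finally show "bdry (edge_unit u v) w = (delta v - delta u) w" by simp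
qed

text \<open>The unit flows along the edges of a walk are added up, and their boundaries
  telescope.\<close>

lemma path_flow:
  assumes "u \<in> V" "v \<in> V"
  shows "\<exists>p\<in>supported E. bdry p = delta v - delta u"
proof -
  have "(u, v) \<in> {(x, y). {x, y} \<in> E}\<^sup>*"
    using assms connected by (simp add: connected_sgraph_def)
  then show ?thesis
  proof (induction rule: rtrancl_induct)
    case base
    show ?case
      by (intro bexI[of _ 0]) (simp_all only: bdry_zero diff_self fs.subspace_0[OF subspace_supported])
  next
    case (step y z)
    then obtain p where p: "p \<in> supported E" "bdry p = delta y - delta u" by blast
    have "p + edge_unit y z \<in> supported E"
      using step p by (intro fs.subspace_add subspace_supported edge_unit_supported) auto
    moreover have "bdry (p + edge_unit y z) = delta z - delta u"
      using step p by (auto simp: bdry_add bdry_edge_unit)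
    ultimately show ?case by blast
  qed
qed

lemma V_nonempty: "V \<noteq> {}"
  using connected by (simp add: connected_sgraph_def)

text \<open>A boundary has total 0, being paired with a constant function, whose gradient is 0.
  Conversely, when the values of \<open>x\<close> total 0, \<open>x\<close> is the combination of
  the differences \<open>delta v - delta r\<close> with coefficients \<open>x v\<close>, and by
  connectedness each difference is a boundary. The factor 1 matches
  \<open>dim_hyperplane\<close>.\<close>

lemma bdry_image: "bdry ` supported E = {x \<in> supported V. (\<Sum>v\<in>V. 1 * x v) = 0}"
proof (intro equalityI subsetI)
  fix x assume "x \<in> bdry ` supported E"
  then obtain f where f: "x = bdry f" by blast
  have "(\<Sum>v\<in>V. bdry f v * 1) = (\<Sum>e\<in>E. f e * grad (\<lambda>_. 1) e)" by (simp only: sum_grad)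
  also have "\<dots> = 0" by (simp add: grad_def)
  finally show "x \<in> {x \<in> supported V. (\<Sum>v\<in>V. 1 * x v) = 0}"
    using f bdry_outside by (auto simp: supported_def)
next
  fix x assume x: "x \<in> {x \<in> supported V. (\<Sum>v\<in>V. 1 * x v) = 0}"
  obtain r where r: "r \<in> V" using V_nonempty by blast
  have "\<forall>v\<in>V. \<exists>p\<in>supported E. bdry p = delta v - delta r" using path_flow r by blast
  then obtain p where p: "\<And>v. v \<in> V \<Longrightarrow> p v \<in> supported E \<and> bdry (p v) = delta v - delta r"
    by metis
  define f where "f = (\<Sum>v\<in>V. fscale (x v) (p v))"
  have "f \<in> supported E" unfolding f_def
    using p by (intro fs.subspace_sum fs.subspace_scale subspace_supported) auto
  moreover have "bdry f = (\<Sum>v\<in>V. fscale (x v) (bdry (p v)))"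
    unfolding f_def by (simp only: fsp.linear_sum[OF linear_bdry] bdry_fscale)
  then have "bdry f = (\<Sum>v\<in>V. fscale (x v) (delta v - delta r))"
    using p by simp
  then have "bdry f = (\<Sum>v\<in>V. fscale (x v) (delta v)) - (\<Sum>v\<in>V. fscale (x v) (delta r))"
    by (simp add: fs.scale_right_diff_distrib sum_subtractf)
  then have "bdry f = x"
    using x supported_expand[OF finite_V, of x] by (simp flip: fs.scale_sum_left)
  ultimately show "x \<in> bdry ` supported E" by blast
qed

lemma dim_flows: "fs.dim flows + card V = card E + 1"
proof -
  obtain r where r: "r \<in> V" using V_nonempty by blast
  have "fs.dim (supported E) = fs.dim (supported E \<inter> {x. bdry x = 0}) + fs.dim (bdry ` supported E)"
    using fsp.rank_nullity[OF linear_bdry subspace_supported supported_subset_span[OF finite_E]] finite_E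
    by auto
  moreover have "supported E \<inter> {x. bdry x = 0} = flows" by (auto simp: flows_def)
  moreover have "Suc (fs.dim (bdry ` supported E)) = card V"
    unfolding bdry_image by (rule dim_hyperplane[OF finite_V r]) simp
  ultimately show ?thesis using dim_supported[OF finite_E] by simp
qed

lemma twist_grad_image: "(\<lambda>x. twist (grad x)) ` lap_kernel = sform_radical"
proof (intro equalityI subsetI)
  fix f assume "f \<in> (\<lambda>x. twist (grad x)) ` lap_kernel"
  then obtain x where x: "x \<in> lap_kernel" "f = twist (grad x)" by blast
  have "f \<in> flows" using x lap_kernel_iff by (auto simp: flows_def supported_def twist_def grad_def)
  moreover have "sform f g = 0" if g: "g \<in> flows" for g
  proof -
    have "sform f g = (\<Sum>e\<in>E. g e * grad x e)"
      unfolding sform_def x(2) using sg_sq by (intro sum.cong) (auto simp: twist_def)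
    also have "\<dots> = 0" using g by (simp add: sum_grad flows_def)
    finally show ?thesis .
  qed
  ultimately show "f \<in> sform_radical" by (simp add: sform_radical_def)
next
  fix f assume f: "f \<in> sform_radical"
  then have ff: "f \<in> flows" by (simp add: sform_radical_def)
  obtain r where r: "r \<in> V" using V_nonempty by blast
  have "\<forall>v\<in>V. \<exists>p\<in>supported E. bdry p = delta v - delta r" using path_flow r by blast
  then obtain p where p: "\<And>v. v \<in> V \<Longrightarrow> p v \<in> supported E \<and> bdry (p v) = delta v - delta r"
    by metis
  \<comment> \<open>The potential at \<open>v\<close> integrates \<open>twist f\<close> along a path from \<open>r\<close> to \<open>v\<close>; changing the path adds a flow.\<close>
  define x where "x v = (if v \<in> V then sform f (p v) else 0)" for v
  have "x (head e) - x (tail e) = sg e * f e" if e: "e \<in> E" for e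
  proof -
    \<comment> \<open>The path to the head, minus the path to the tail, minus the edge itself closes
      up to a flow. Orthogonality of \<open>f\<close> to it equates the potential difference across
      \<open>e\<close> with \<open>sg e * f e\<close>.\<close>
    let ?u = "edge_unit (tail e) (head e)"
    let ?g = "p (head e) - p (tail e) - ?u"
    have te: "{tail e, head e} \<in> E" using e by (simp flip: edge_ends(1)[OF e])
    have "?g \<in> supported E"
      using ends_in_V[OF e] p te by (intro fs.subspace_diff subspace_supported edge_unit_supported) auto
    moreover have "bdry ?g = 0"
      using ends_in_V[OF e] p te by (simp add: bdry_diff bdry_edge_unit)
    ultimately have "sform f ?g = 0" using f by (simp add: sform_radical_def flows_def)
    then have "sform f (p (head e)) - sform f (p (tail e)) = sform f ?u"
      by (simp add: sform_diff)
    moreover have "sform f ?u = (\<Sum>e'\<in>E. if e' = e then sg e * f e else 0)"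
      unfolding sform_def by (intro sum.cong) (auto simp: edge_unit_def simp flip: edge_ends(1)[OF e])
    ultimately show ?thesis using ends_in_V[OF e] e finite_E by (simp add: x_def)
  qed
  \<comment> \<open>Twisting undoes itself, since every sign squares to 1.\<close>
  then have "twist (grad x) e = f e" for e
    using ff sg_sq[of e] by (cases "e \<in> E") (auto simp: twist_def grad_def flows_def supported_def simp flip: mult.assoc)
  then have tg: "twist (grad x) = f" by auto
  moreover have "x \<in> lap_kernel"
    using ff tg by (auto simp: lap_kernel_iff flows_def supported_def x_def)
  ultimately show "f \<in> (\<lambda>x. twist (grad x)) ` lap_kernel" by blast
qed

lemma grad_zero_const:
  assumes "twist (grad x) = 0" "u \<in> V" "v \<in> V"
  shows "x u = x v"
proof -
  have "(u, v) \<in> {(x, y). {x, y} \<in> E}\<^sup>*"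
    using assms connected by (simp add: connected_sgraph_def)
  then show ?thesis
  proof (induction rule: rtrancl_induct)
    case (step y z)
    then have e: "{y, z} \<in> E" by simp
    have "twist (grad x) {y, z} = 0" using assms(1) by simp
    then have "x (head {y, z}) = x (tail {y, z})"
      using e sg_sq[OF e] by (auto simp: twist_def grad_def)
    then have "x y = x z" using ends_of_pair[OF e] by auto
    then show ?case using step by simp
  qed simp
qed

lemma dim_lap_kernel: "fs.dim lap_kernel = 1 + fs.dim sform_radical"
proof -
  \<comment> \<open>The constant function 1 on the vertices, extended by zero.\<close>
  let ?c = "\<lambda>v. of_bool (v \<in> V) :: real"
  have lin: "Vector_Spaces.linear fscale fscale (\<lambda>x. twist (grad x))"
    by (rule fs_linearI) (auto simp: fun_eq_iff algebra_simps twist_def grad_def)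
  have sub: "lap_kernel \<subseteq> supported V" by (auto simp: mat_fun_kernel_def)
  have "lap_kernel \<inter> {x. twist (grad x) = 0} = fs.span {?c}"
  proof (intro equalityI subsetI)
    fix x assume x: "x \<in> lap_kernel \<inter> {x. twist (grad x) = 0}"
    obtain r where r: "r \<in> V" using V_nonempty by blast
    have "x v = fscale (x r) ?c v" for v
      using x sub grad_zero_const[of x v r] r by (cases "v \<in> V") (auto simp: supported_def)
    then have x_eq: "fscale (x r) ?c = x" by (intro ext) (rule sym)
    have "fscale (x r) ?c \<in> fs.span {?c}" by (intro fs.span_scale fs.span_base) simp
    then show "x \<in> fs.span {?c}" unfolding x_eq .
  next
    have "?c \<in> lap_kernel \<inter> {x. twist (grad x) = 0}"
      using ends_in_V bdry_zero by (auto simp: lap_kernel_iff supported_def twist_def grad_def fun_eq_iff bdry_def)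
    moreover have "fs.subspace (lap_kernel \<inter> {x. twist (grad x) = 0})"
      using fsp.linear_subspace_kernel[OF lin] subspace_mat_fun_kernel by (intro fs.subspace_inter)
    ultimately have "fs.span {?c} \<subseteq> lap_kernel \<inter> {x. twist (grad x) = 0}"
      by (intro fs.span_minimal) auto
    then show "x \<in> lap_kernel \<inter> {x. twist (grad x) = 0}" if "x \<in> fs.span {?c}" for x using that by blast
  qed
  moreover have "fs.independent {?c}"
  proof -
    have "?c \<noteq> 0" using V_nonempty by (auto simp: fun_eq_iff)
    then show ?thesis using fs.independent_insertI[of ?c "{}"] fs.independent_empty by simp
  qed
  ultimately have "fs.dim (lap_kernel \<inter> {x. twist (grad x) = 0}) = 1"
    by (simp add: fs.dim_eq_card_independent)
  moreover have "fs.dim lap_kernel = fs.dim (lap_kernel \<inter> {x. twist (grad x) = 0}) + fs.dim ((\<lambda>x. twist (grad x)) ` lap_kernel)"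
    using sub supported_subset_span[OF finite_V] finite_V
    by (intro fsp.rank_nullity[OF lin subspace_mat_fun_kernel]) auto
  ultimately show ?thesis by (simp add: twist_grad_image)
qed

end

section \<open>Cycles and cactus graphs\<close>

lemma mod_Suc_less: "i < l \<Longrightarrow> Suc i mod l = (if Suc i = l then 0 else Suc i)"
  by auto

lemma bij_betw_cyclic_Suc:
  assumes "0 < (l::nat)"
  shows "bij_betw (\<lambda>i. Suc i mod l) {..<l} {..<l}"
proof -
  have "inj_on (\<lambda>i. Suc i mod l) {..<l}"
    by (rule inj_onI) (auto simp: mod_Suc_less split: if_splits)
  moreover have "(\<lambda>i. Suc i mod l) ` {..<l} \<subseteq> {..<l}" using assms by auto
  ultimately show ?thesis by (simp add: bij_betw_def endo_inj_surj)
qed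

text \<open>Equal edges at different positions would make each position the cyclic successor of the
  other, which happens only for length 2.\<close>

lemma inj_on_cycle_edges:
  assumes "distinct c" "3 \<le> length c"
  shows "inj_on (\<lambda>i. {c ! i, c ! (Suc i mod length c)}) {..<length c}"
proof (rule inj_onI)
  define l where "l = length c"
  fix i j assume ij: "i \<in> {..<length c}" "j \<in> {..<length c}"
    and eq: "{c ! i, c ! (Suc i mod length c)} = {c ! j, c ! (Suc j mod length c)}"
  have "0 < l" using assms(2) unfolding l_def by linarith
  then have l: "i < l" "j < l" "3 \<le> l" "Suc i mod l < l" "Suc j mod l < l"
    using ij assms(2) by (auto simp: l_def)
  have nth: "c ! a = c ! b \<longleftrightarrow> a = b" if "a < l" "b < l" for a b
    using that assms(1) by (simp add: nth_eq_iff_index_eq l_def)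
  have "i = j \<or> i = Suc j mod l \<and> Suc i mod l = j"
    using eq l nth by (auto simp: doubleton_eq_iff l_def[symmetric])
  moreover have "\<not> (i = Suc j mod l \<and> Suc i mod l = j)"
    using l(1-3) by (auto simp: mod_Suc_less split: if_splits)
  ultimately show "i = j" by blast
qed

text \<open>\<open>ext\<close> says that no vertex is a leaf of \<open>S\<close>. A longest path
  then has a second edge at its first vertex, and by maximality this edge leads back into the
  path.\<close>

lemma cycle_list_exists:
  assumes "finite V" and "S \<noteq> {}"
    and S: "\<And>e. e \<in> S \<Longrightarrow> e \<subseteq> V \<and> card e = 2"
    and ext: "\<And>v w. {v, w} \<in> S \<Longrightarrow> \<exists>w'. w' \<noteq> w \<and> {v, w'} \<in> S"
  shows "\<exists>c. 3 \<le> length c \<and> distinct c \<and> (\<forall>i<length c. {c ! i, c ! (Suc i mod length c)} \<in> S)"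
proof -
  define P where "P p \<longleftrightarrow> 2 \<le> length p \<and> distinct p \<and> set p \<subseteq> V \<and>
    (\<forall>i. Suc i < length p \<longrightarrow> {p ! i, p ! Suc i} \<in> S)" for p
  have bound: "length p < Suc (card V)" if "P p" for p
  proof -
    have "length p = card (set p)" using that distinct_card[of p] by (simp add: P_def)
    also have "\<dots> \<le> card V" using that assms(1) by (intro card_mono) (simp_all add: P_def)
    finally show ?thesis by simp
  qed
  obtain e where e: "e \<in> S" using assms(2) by blast
  then obtain x y where xy: "e = {x, y}" "x \<noteq> y" using S[OF e] by (auto simp: card_2_iff)
  have "P [x, y]" using e xy S[OF e] by (auto simp: P_def)
  then obtain p where p: "P p" and max: "\<And>q. P q \<Longrightarrow> length q \<le> length p"
    using ex_has_greatest_nat[of P "[x, y]" length "Suc (card V)"] bound by blast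
  have p01: "{p ! 0, p ! 1} \<in> S" using p by (auto simp: P_def)
  then obtain w where w: "w \<noteq> p ! 1" "{p ! 0, w} \<in> S" using ext by blast
  have w0: "w \<noteq> p ! 0" using S[OF w(2)] by auto
  have "w \<in> set p"
  proof (rule ccontr)
    assume "w \<notin> set p"
    then have "P (w # p)"
      using p w S[OF w(2)] by (auto simp: P_def nth_Cons insert_commute split: nat.split)
    then show False using max[of "w # p"] by simp
  qed
  then obtain j where j: "j < length p" "p ! j = w" by (auto simp: in_set_conv_nth)
  \<comment> \<open>The second edge avoids both of the first two vertices of the path, so the closed
    prefix has at least 3 vertices.\<close>
  have j2: "2 \<le> j"
  proof (rule ccontr)
    assume "\<not> 2 \<le> j"
    then have "j = 0 \<or> j = 1" by auto
    then show False using j w w0 by auto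
  qed
  define c where "c = take (Suc j) p"
  have lc: "length c = Suc j" using j by (simp add: c_def)
  have "{c ! i, c ! (Suc i mod length c)} \<in> S" if i: "i < length c" for i
  proof (cases "i = j")
    case True
    then show ?thesis using w j by (simp add: lc c_def insert_commute)
  next
    case False
    then have "i < j" using i lc by simp
    then show ?thesis using p j by (simp add: lc c_def P_def)
  qed
  moreover have "distinct c" using p by (simp add: c_def P_def)
  ultimately show ?thesis using lc j2 by (intro exI[of _ c]) simp
qed

context conn_signed_graph
begin

text \<open>Conservation at \<open>v\<close>: a single nonzero contribution cannot cancel.\<close>

lemma flow_continues:
  assumes f: "f \<in> flows" and e: "e \<in> E" "f e \<noteq> 0" "v \<in> e"
  shows "\<exists>e'\<in>E. f e' \<noteq> 0 \<and> v \<in> e' \<and> e' \<noteq> e"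
proof (rule ccontr)
  assume *: "\<not> ?thesis"
  have "f e' * inc e' v = 0" if "e' \<in> E - {e}" for e'
    using * that mem_edge_iff[of e' v] by (auto simp: inc_def)
  then have "(\<Sum>e'\<in>E - {e}. f e' * inc e' v) = 0" by (intro sum.neutral) blast
  then have "bdry f v = f e * inc e v"
    using e(1) finite_E by (simp add: bdry_def sum.remove)
  moreover have "inc e v \<noteq> 0"
    using e(3) mem_edge_iff[OF e(1), of v] edge_ends(2)[OF e(1)] by (auto simp: inc_def)
  ultimately show False using f e(2) by (simp add: flows_def)
qed

lemma flow_contains_cycle:
  assumes f: "f \<in> flows" "f \<noteq> 0"
  shows "\<exists>C\<in>cycles \<Gamma>. \<forall>e\<in>C. f e \<noteq> 0"
proof -
  define S where "S = {e \<in> E. f e \<noteq> 0}"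
  have "S \<noteq> {}" using f by (auto simp: S_def flows_def supported_def fun_eq_iff)
  moreover have "e \<subseteq> V \<and> card e = 2" if "e \<in> S" for e
    using that signed by (auto simp: S_def signed_graph_def)
  moreover have "\<exists>w'. w' \<noteq> w \<and> {v, w'} \<in> S" if vw: "{v, w} \<in> S" for v w
  proof -
    obtain e' where e': "e' \<in> E" "f e' \<noteq> 0" "v \<in> e'" "e' \<noteq> {v, w}"
      using flow_continues[OF f(1), of "{v, w}" v] vw by (auto simp: S_def)
    obtain w' where "e' = {v, w'}"
      using mem_edge_iff[OF e'(1), of v] e'(3) ends_eq_iff[OF e'(1)] by metis
    then show ?thesis using e' by (auto simp: S_def)
  qed
  ultimately obtain c where c: "3 \<le> length c" "distinct c"
      "\<forall>i<length c. {c ! i, c ! (Suc i mod length c)} \<in> S"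
    using cycle_list_exists[OF finite_V, of S] by blast
  then have "cycle_list \<Gamma> c" by (auto simp: cycle_list_def S_def)
  then have "{{c ! i, c ! (Suc i mod length c)} | i. i < length c} \<in> cycles \<Gamma>"
    unfolding cycles_def by blast
  then show ?thesis using c(3) by (intro bexI) (auto simp: S_def)
qed

lemma cycle_subset: "C \<in> cycles \<Gamma> \<Longrightarrow> C \<subseteq> E \<and> C \<noteq> {}"
proof -
  assume "C \<in> cycles \<Gamma>"
  then obtain c where c: "cycle_list \<Gamma> c" and C: "C = {{c ! i, c ! (Suc i mod length c)} | i. i < length c}"
    by (auto simp: cycles_def)
  have "0 < length c" using c by (auto simp: cycle_list_def)
  then have "{c ! 0, c ! (Suc 0 mod length c)} \<in> C" unfolding C by blast
  then show ?thesis using c by (auto simp: C cycle_list_def)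
qed

text \<open>One unit is pushed around the traversal. Only absolute values are recorded, as the signs
  depend on the orientation of the edges and on the direction of travel.\<close>

lemma cycle_flow:
  assumes "C \<in> cycles \<Gamma>"
  shows "\<exists>g\<in>flows. \<forall>e. \<bar>g e\<bar> = of_bool (e \<in> C)"
proof -
  obtain c where c: "cycle_list \<Gamma> c" and C: "C = {{c ! i, c ! (Suc i mod length c)} | i. i < length c}"
    using assms by (auto simp: cycles_def)
  define l where "l = length c"
  define ce where "ce = (\<lambda>i. {c ! i, c ! (Suc i mod l)})"
  have l3: "3 \<le> l" "distinct c" and ceE: "\<And>i. i < l \<Longrightarrow> ce i \<in> E"
    using c by (auto simp: cycle_list_def l_def ce_def)
  have inj: "inj_on ce {..<l}"
    using inj_on_cycle_edges[of c] l3 by (simp add: ce_def l_def)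
  define g where "g = (\<Sum>i<l. edge_unit (c ! i) (c ! (Suc i mod l)))"
  have "g \<in> supported E" unfolding g_def
    using ceE by (intro fs.subspace_sum subspace_supported edge_unit_supported) (auto simp: ce_def)
  moreover have "bdry g = 0"
  proof -
    have "bdry g = (\<Sum>i<l. bdry (edge_unit (c ! i) (c ! (Suc i mod l))))"
      unfolding g_def by (rule fsp.linear_sum[OF linear_bdry])
    also have "\<dots> = (\<Sum>i<l. delta (c ! (Suc i mod l)) - delta (c ! i))"
      using ceE by (intro sum.cong bdry_edge_unit) (auto simp: ce_def)
    also have "\<dots> = (\<Sum>i<l. delta (c ! (Suc i mod l))) - (\<Sum>i<l. delta (c ! i))"
      by (rule sum_subtractf)
    also have "(\<Sum>i<l. delta (c ! (Suc i mod l))) = (\<Sum>i<l. delta (c ! i))"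
      using l3 by (intro sum.reindex_bij_betw[where g = "\<lambda>i. delta (c ! i)"] bij_betw_cyclic_Suc) simp
    finally show ?thesis by (simp only: diff_self)
  qed
  ultimately have "g \<in> flows" by (simp add: flows_def)
  moreover have "\<bar>g e\<bar> = of_bool (e \<in> C)" for e
  proof (cases "e \<in> C")
    case True
    then obtain k where k: "k < l" "e = ce k" by (auto simp: C ce_def l_def)
    \<comment> \<open>The edges at different positions are distinct, so a single summand survives at
      \<open>e\<close> and nothing cancels.\<close>
    have "g e = (\<Sum>i<l. if i = k then edge_unit (c ! k) (c ! (Suc k mod l)) e else 0)"
      unfolding g_def sum_fun_apply
    proof (intro sum.cong refl)
      fix i assume "i \<in> {..<l}"
      then have "ce i = ce k \<longleftrightarrow> i = k" using inj k by (auto simp: inj_on_def)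
      then show "edge_unit (c ! i) (c ! (Suc i mod l)) e
          = (if i = k then edge_unit (c ! k) (c ! (Suc k mod l)) e else 0)"
        using k by (auto simp: edge_unit_def ce_def)
    qed
    also have "\<dots> = edge_unit (c ! k) (c ! (Suc k mod l)) e" using k by simp
    finally show ?thesis using k True by (auto simp: edge_unit_def ce_def)
  next
    case False
    have "edge_unit (c ! i) (c ! (Suc i mod l)) e = 0" if "i < l" for i
    proof -
      have "e \<noteq> {c ! i, c ! (Suc i mod l)}" using False that unfolding C l_def by blast
      then show ?thesis by (simp add: edge_unit_def)
    qed
    then have "g e = 0" unfolding g_def sum_fun_apply by (intro sum.neutral) simp
    then show ?thesis using False by simp
  qed
  ultimately show ?thesis by blast
qed

text \<open>A choice between the two directions of circulation; spans and values of
  \<open>sform\<close> on equal arguments are insensitive to it.\<close>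

definition cycle_vec :: "'a set set \<Rightarrow> 'a set \<Rightarrow> real" where
  "cycle_vec C = (SOME g. g \<in> flows \<and> (\<forall>e. \<bar>g e\<bar> = of_bool (e \<in> C)))"

lemma cycle_vec:
  assumes "C \<in> cycles \<Gamma>"
  shows "cycle_vec C \<in> flows" "\<bar>cycle_vec C e\<bar> = of_bool (e \<in> C)"
proof -
  have "\<exists>g. g \<in> flows \<and> (\<forall>e. \<bar>g e\<bar> = of_bool (e \<in> C))" using cycle_flow[OF assms] by blast
  then have "cycle_vec C \<in> flows \<and> (\<forall>e. \<bar>cycle_vec C e\<bar> = of_bool (e \<in> C))"
    unfolding cycle_vec_def by (rule someI_ex)
  then show "cycle_vec C \<in> flows" "\<bar>cycle_vec C e\<bar> = of_bool (e \<in> C)" by auto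
qed

lemma cycle_vec_zero_iff: "C \<in> cycles \<Gamma> \<Longrightarrow> cycle_vec C e = 0 \<longleftrightarrow> e \<notin> C"
  using cycle_vec(2)[of C e] by (auto split: if_splits)

text \<open>Induction on the size of the support. A nonzero flow has a cycle inside its support, and
  subtracting a multiple of that cycle's vector removes one edge from the support without adding
  any.\<close>

lemma flows_eq_span: "flows = fs.span (cycle_vec ` cycles \<Gamma>)"
proof (intro equalityI subsetI)
  fix f assume "f \<in> flows"
  then show "f \<in> fs.span (cycle_vec ` cycles \<Gamma>)"
  proof (induction "card {e \<in> E. f e \<noteq> 0}" arbitrary: f rule: less_induct)
    case less
    show ?case
    proof (cases "f = 0")
      case True
      then show ?thesis using fs.span_zero by simp
    next
      case False
      obtain C where C: "C \<in> cycles \<Gamma>" "\<forall>e\<in>C. f e \<noteq> 0"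
        using flow_contains_cycle[OF less.prems False] by blast
      obtain d where d: "d \<in> C" using cycle_subset[OF C(1)] by blast
      \<comment> \<open>The multiple is chosen to cancel the flow on the edge
        \<open>d\<close>.\<close>
      define t where "t = f d / cycle_vec C d"
      define g where "g = f - fscale t (cycle_vec C)"
      have gf: "g \<in> flows" unfolding g_def
        using less.prems C by (intro fs.subspace_diff fs.subspace_scale subspace_flows cycle_vec)
      have "g d = 0" using cycle_vec_zero_iff[OF C(1), of d] d by (simp add: g_def t_def)
      then have "d \<in> {e \<in> E. f e \<noteq> 0} - {e \<in> E. g e \<noteq> 0}"
        using d C cycle_subset by auto
      moreover have "{e \<in> E. g e \<noteq> 0} \<subseteq> {e \<in> E. f e \<noteq> 0}"
        using C cycle_vec_zero_iff[OF C(1)] by (auto simp: g_def)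
      ultimately have "{e \<in> E. g e \<noteq> 0} \<subset> {e \<in> E. f e \<noteq> 0}" by blast
      then have "g \<in> fs.span (cycle_vec ` cycles \<Gamma>)"
        using gf finite_E by (intro less.hyps psubset_card_mono) auto
      then have "g + fscale t (cycle_vec C) \<in> fs.span (cycle_vec ` cycles \<Gamma>)"
        using C by (intro fs.span_add[OF _ fs.span_scale[OF fs.span_base]]) auto
      then show ?thesis by (simp add: g_def)
    qed
  qed
next
  have "fs.span (cycle_vec ` cycles \<Gamma>) \<subseteq> flows"
    by (intro fs.span_minimal subspace_flows) (auto intro: cycle_vec)
  then show "f \<in> flows" if "f \<in> fs.span (cycle_vec ` cycles \<Gamma>)" for f using that by blast
qed

text \<open>The values on \<open>C\<close> square to 1, which leaves the sum of the signs along
  \<open>C\<close>.\<close>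

lemma sform_cycle_vec_same:
  assumes C: "C \<in> cycles \<Gamma>"
  shows "sform (cycle_vec C) (cycle_vec C) = real (m_pos \<Gamma> C) - real (m_neg \<Gamma> C)"
proof -
  have CE: "C \<subseteq> E" using cycle_subset[OF C] by simp
  have finC: "finite C" using CE finite_E finite_subset by blast
  have sq: "cycle_vec C e * cycle_vec C e = of_bool (e \<in> C)" for e
    using cycle_vec(2)[OF C, of e] by (metis abs_mult_self_eq mult_1 mult_zero_left of_bool_def)
  have "sform (cycle_vec C) (cycle_vec C) = (\<Sum>e\<in>E. sg e * of_bool (e \<in> C))"
    by (simp add: sform_def sq mult.assoc)
  also have "\<dots> = (\<Sum>e\<in>C. sg e)"
    using CE finite_E by (intro sum.mono_neutral_cong_right) auto
  also have "\<dots> = (\<Sum>e\<in>C. of_bool (sigma \<Gamma> e = 1) - of_bool (sigma \<Gamma> e = -1))"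
    using sigma_cases CE by (intro sum.cong) force+
  also have "\<dots> = real (m_pos \<Gamma> C) - real (m_neg \<Gamma> C)"
  proof -
    have "C \<inter> {e. sigma \<Gamma> e = k} = {e \<in> C. sigma \<Gamma> e = k}" for k by auto
    then show ?thesis
      using finC by (simp add: sum_subtractf sum.If_cases of_bool_def m_pos_def m_neg_def)
  qed
  finally show ?thesis .
qed

section \<open>Cactus graphs: the form is diagonal on cycle vectors\<close>

context
  assumes cactus: "signed_cactus \<Gamma>"
begin

lemma cycles_disjoint: "C \<in> cycles \<Gamma> \<Longrightarrow> D \<in> cycles \<Gamma> \<Longrightarrow> C \<noteq> D \<Longrightarrow> C \<inter> D = {}"
  using cactus by (auto simp: signed_cactus_def)

lemma sform_cycle_vec_diff:
  assumes "C \<in> cycles \<Gamma>" "D \<in> cycles \<Gamma>" "C \<noteq> D"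
  shows "sform (cycle_vec C) (cycle_vec D) = 0"
  unfolding sform_def
proof (intro sum.neutral ballI)
  fix e
  show "sg e * cycle_vec C e * cycle_vec D e = 0"
    using cycles_disjoint[OF assms] cycle_vec_zero_iff[OF assms(1), of e] cycle_vec_zero_iff[OF assms(2), of e]
    by auto
qed

text \<open>It suffices to test against the spanning cycle vectors: disjoint supports handle the
  other cycles, the balance hypothesis handles \<open>C\<close> itself.\<close>

lemma cycle_vec_in_radical:
  assumes "C \<in> cycles \<Gamma>" "m_pos \<Gamma> C = m_neg \<Gamma> C"
  shows "cycle_vec C \<in> sform_radical"
proof -
  have "cycle_vec ` cycles \<Gamma> \<subseteq> {g. sform (cycle_vec C) g = 0}"
    using assms sform_cycle_vec_diff[OF assms(1)] sform_cycle_vec_same[OF assms(1)] by force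
  moreover have "fs.subspace {g. sform (cycle_vec C) g = 0}"
    by (auto simp: fs.subspace_def sform_add sform_fscale sform_zero)
  ultimately have "flows \<subseteq> {g. sform (cycle_vec C) g = 0}"
    unfolding flows_eq_span by (rule fs.span_minimal)
  then show ?thesis using cycle_vec(1)[OF assms(1)] by (auto simp: sform_radical_def)
qed

text \<open>All other cycle vectors vanish on \<open>C\<close>, so only multiples of its own vector
  are visible there.\<close>

lemma flow_proportional_on_cycle:
  assumes f: "f \<in> flows" and C: "C \<in> cycles \<Gamma>"
  shows "\<exists>a. \<forall>e\<in>C. f e = a * cycle_vec C e"
proof -
  let ?P = "{f. \<exists>a. \<forall>e\<in>C. f e = a * cycle_vec C e}"
  have "cycle_vec D \<in> ?P" if D: "D \<in> cycles \<Gamma>" for D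
  proof (cases "D = C")
    case True
    then show ?thesis by (auto intro!: exI[of _ 1])
  next
    case False
    then have "cycle_vec D e = 0 * cycle_vec C e" if "e \<in> C" for e
      using that cycles_disjoint[OF C D] cycle_vec_zero_iff[OF D, of e] by auto
    then show ?thesis by blast
  qed
  then have "cycle_vec ` cycles \<Gamma> \<subseteq> ?P" by blast
  moreover have "fs.subspace ?P"
  proof (rule fs.subspaceI)
    show "0 \<in> ?P" by (auto intro!: exI[of _ 0])
    show "x + y \<in> ?P" if xy: "x \<in> ?P" "y \<in> ?P" for x y
    proof -
      obtain a b where "\<forall>e\<in>C. x e = a * cycle_vec C e" "\<forall>e\<in>C. y e = b * cycle_vec C e"
        using xy by blast
      then have "\<forall>e\<in>C. (x + y) e = (a + b) * cycle_vec C e" by (auto simp: algebra_simps)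
      then show ?thesis by blast
    qed
    show "fscale c x \<in> ?P" if x: "x \<in> ?P" for c x
    proof -
      obtain a where "\<forall>e\<in>C. x e = a * cycle_vec C e" using x by blast
      then have "\<forall>e\<in>C. fscale c x e = (c * a) * cycle_vec C e" by auto
      then show ?thesis by blast
    qed
  qed
  ultimately have "flows \<subseteq> ?P" unfolding flows_eq_span by (rule fs.span_minimal)
  then show ?thesis using f by blast
qed

text \<open>A nonzero radical flow is nowhere 0 on some cycle \<open>C\<close>, where it is
  \<open>a\<close> times the cycle vector. Pairing it with that vector gives \<open>a\<close> times
  the imbalance of \<open>C\<close>, so \<open>a = 0\<close> if \<open>C\<close> is unbalanced, a
  contradiction.\<close>

lemma radical_trivial_iff: "sform_radical = {0} \<longleftrightarrow> (\<forall>C\<in>cycles \<Gamma>. m_pos \<Gamma> C \<noteq> m_neg \<Gamma> C)"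
proof
  assume R: "sform_radical = {0}"
  show "\<forall>C\<in>cycles \<Gamma>. m_pos \<Gamma> C \<noteq> m_neg \<Gamma> C"
  proof (intro ballI notI)
    fix C assume C: "C \<in> cycles \<Gamma>" "m_pos \<Gamma> C = m_neg \<Gamma> C"
    then have "cycle_vec C = 0" using cycle_vec_in_radical R by blast
    then have "C = {}" using cycle_vec_zero_iff[OF C(1)] by auto
    then show False using cycle_subset C by blast
  qed
next
  assume m: "\<forall>C\<in>cycles \<Gamma>. m_pos \<Gamma> C \<noteq> m_neg \<Gamma> C"
  have "f = 0" if f: "f \<in> sform_radical" for f
  proof (rule ccontr)
    assume "f \<noteq> 0"
    moreover have ff: "f \<in> flows" using f by (simp add: sform_radical_def)
    ultimately obtain C where C: "C \<in> cycles \<Gamma>" "\<forall>e\<in>C. f e \<noteq> 0"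
      using flow_contains_cycle by blast
    obtain a where a: "\<forall>e\<in>C. f e = a * cycle_vec C e"
      using flow_proportional_on_cycle[OF ff C(1)] by blast
    have "0 = sform f (cycle_vec C)" using f cycle_vec(1)[OF C(1)] by (simp add: sform_radical_def)
    also have "\<dots> = (\<Sum>e\<in>E. sg e * (a * cycle_vec C e) * cycle_vec C e)"
      unfolding sform_def
    proof (intro sum.cong refl)
      fix e
      show "sg e * f e * cycle_vec C e = sg e * (a * cycle_vec C e) * cycle_vec C e"
        using a cycle_vec_zero_iff[OF C(1), of e] by (cases "e \<in> C") auto
    qed
    also have "\<dots> = a * sform (cycle_vec C) (cycle_vec C)"
      by (simp add: sform_def sum_distrib_left algebra_simps)
    finally have "a = 0" using m C(1) sform_cycle_vec_same[OF C(1)] by auto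
    then show False using a C cycle_subset[OF C(1)] by auto
  qed
  then show "sform_radical = {0}" using fs.subspace_0[OF subspace_radical] by blast
qed

lemma radical_full_iff: "sform_radical = flows \<longleftrightarrow> (\<forall>C\<in>cycles \<Gamma>. m_pos \<Gamma> C = m_neg \<Gamma> C)"
proof
  assume R: "sform_radical = flows"
  show "\<forall>C\<in>cycles \<Gamma>. m_pos \<Gamma> C = m_neg \<Gamma> C"
  proof
    fix C assume C: "C \<in> cycles \<Gamma>"
    then have "cycle_vec C \<in> sform_radical" using R cycle_vec(1) by simp
    then have "sform (cycle_vec C) (cycle_vec C) = 0"
      using cycle_vec(1)[OF C] by (simp add: sform_radical_def)
    then show "m_pos \<Gamma> C = m_neg \<Gamma> C" using sform_cycle_vec_same[OF C] by simp
  qed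
next
  assume "\<forall>C\<in>cycles \<Gamma>. m_pos \<Gamma> C = m_neg \<Gamma> C"
  then have "cycle_vec ` cycles \<Gamma> \<subseteq> sform_radical" using cycle_vec_in_radical by blast
  then have "flows \<subseteq> sform_radical"
    unfolding flows_eq_span by (intro fs.span_minimal subspace_radical)
  then show "sform_radical = flows" by (auto simp: sform_radical_def)
qed

end

section \<open>The dimension of the radical and the cyclomatic number\<close>

lemma radical_subset_flows: "sform_radical \<subseteq> flows"
  by (auto simp: sform_radical_def)

lemma flows_finite_dim: "flows \<subseteq> fs.span (delta ` E)"
proof -
  have "flows \<subseteq> supported E" by (auto simp: flows_def)
  then show ?thesis using supported_subset_span[OF finite_E] by (rule order_trans)
qed

lemma dim_flows_cyclomatic: "int (fs.dim flows) = cyclomatic \<Gamma>"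
  using dim_flows by (simp add: cyclomatic_def)

lemma dim_radical_le: "fs.dim sform_radical \<le> fs.dim flows"
  using subspace_radical radical_subset_flows flows_finite_dim finite_E
  by (intro fs.subspace_dim_mono) auto

lemma dim_radical_eq_flows_iff: "fs.dim sform_radical = fs.dim flows \<longleftrightarrow> sform_radical = flows"
  using fs.subspace_dim_psubset[OF subspace_radical _ flows_finite_dim] radical_subset_flows finite_E
  by (metis finite_imageI less_irrefl psubsetI)

lemma dim_radical_eq_0_iff: "fs.dim sform_radical = 0 \<longleftrightarrow> sform_radical = {0}"
proof
  assume d: "fs.dim sform_radical = 0"
  show "sform_radical = {0}"
  proof (rule ccontr)
    assume "sform_radical \<noteq> {0}"
    then have "{0} \<subset> sform_radical" using fs.subspace_0[OF subspace_radical] by blast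
    then have "fs.dim {0 :: 'a set \<Rightarrow> real} < fs.dim sform_radical"
      using radical_subset_flows flows_finite_dim finite_E
      by (intro fs.subspace_dim_psubset[of _ _ "delta ` E"]) auto
    then show False using d by simp
  qed
next
  assume "sform_radical = {0}"
  moreover have "fs.dim {0 :: 'a set \<Rightarrow> real} = 0"
    using fs.dim_unique[of "{}" "{0}" 0] by (simp add: fs.independent_empty)
  ultimately show "fs.dim sform_radical = 0" by simp
qed

end

section \<open>Kernels of codimension one\<close>

lemma image_two_subsets:
  assumes "bij_betw f A B"
  shows "(`) f ` {e. e \<subseteq> A \<and> card e = 2} = {e. e \<subseteq> B \<and> card e = 2}"
proof (intro equalityI subsetI)
  fix e' assume "e' \<in> (`) f ` {e. e \<subseteq> A \<and> card e = 2}"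
  then obtain e where e: "e' = f ` e" "e \<subseteq> A" "card e = 2" by blast
  have "card e' = card e"
    using e assms by (metis card_image bij_betw_imp_inj_on inj_on_subset)
  then show "e' \<in> {e. e \<subseteq> B \<and> card e = 2}"
    using e assms by (auto simp: bij_betw_def)
next
  fix e' assume "e' \<in> {e. e \<subseteq> B \<and> card e = 2}"
  then obtain a b where ab: "e' = {a, b}" "a \<noteq> b" "a \<in> B" "b \<in> B" by (auto simp: card_2_iff)
  then obtain u v where uv: "u \<in> A" "v \<in> A" "f u = a" "f v = b"
    using assms by (auto simp: bij_betw_def)
  then have "{u, v} \<in> {e. e \<subseteq> A \<and> card e = 2}" using ab by (auto simp: card_2_iff)
  moreover have "e' = f ` {u, v}" using ab uv by simp
  ultimately show "e' \<in> (`) f ` {e. e \<subseteq> A \<and> card e = 2}" by blast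
qed

section \<open>The negative join of two complete graphs and balanced signings\<close>

lemma verts_neg_join_complete:
  "verts (neg_join (complete_sgraph k) (complete_sgraph k)) = {..<k} <+> {..<k}"
  by (simp add: neg_join_def complete_sgraph_def)

lemma edges_neg_join_complete:
  "edges (neg_join (complete_sgraph k) (complete_sgraph k)) =
     {e. e \<subseteq> {..<k} <+> {..<k} \<and> card e = 2}" (is "_ = ?R")
proof (intro equalityI subsetI)
  fix e assume e: "e \<in> edges (neg_join (complete_sgraph k) (complete_sgraph k))"
  have c: "card (Inl ` d :: (nat + nat) set) = card d" "card (Inr ` d :: (nat + nat) set) = card d"
    for d :: "nat set" by (simp_all add: card_image)
  from e show "e \<in> ?R"
    by (auto simp: neg_join_def complete_sgraph_def c)
next
  fix e assume "e \<in> ?R"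
  then obtain a b where e: "e = {a, b}" "a \<noteq> b" "a \<in> {..<k} <+> {..<k}" "b \<in> {..<k} <+> {..<k}"
    by (auto simp: card_2_iff)
  let ?P = "{e. e \<subseteq> {..<k} \<and> card e = 2}"
  consider i j where "a = Inl i" "b = Inl j" | i j where "a = Inr i" "b = Inr j"
    | i j where "e = {Inl i, Inr j}" "i < k" "j < k"
    using e by (cases a; cases b) (auto simp: insert_commute)
  then have "e \<in> (`) Inl ` ?P \<union> (`) Inr ` ?P \<union> {{Inl u, Inr v} | u v. u \<in> {..<k} \<and> v \<in> {..<k}}"
  proof cases
    case (1 i j)
    then have "{i, j} \<in> ?P" "e = Inl ` {i, j}" using e by auto
    then show ?thesis by blast
  next
    case (2 i j)
    then have "{i, j} \<in> ?P" "e = Inr ` {i, j}" using e by auto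
    then show ?thesis by blast
  next
    case 3
    then show ?thesis by blast
  qed
  then show "e \<in> edges (neg_join (complete_sgraph k) (complete_sgraph k))"
    by (simp add: neg_join_def complete_sgraph_def)
qed

lemma sigma_neg_join_complete:
  "sigma (neg_join (complete_sgraph k) (complete_sgraph k)) {a, b} = (if isl a = isl b then 1 else -1)"
  by (cases a; cases b) (auto simp: neg_join_def complete_sgraph_def)

lemma verts_neg_sgraph [simp]: "verts (neg_sgraph \<Gamma>) = verts \<Gamma>"
  by (simp add: neg_sgraph_def)

text \<open>Moving the reversal of signs to the other side reduces the negated join to the join
  itself.\<close>

lemma sgraph_iso_neg_iff: "sgraph_iso \<Gamma> (neg_sgraph H) \<longleftrightarrow> sgraph_iso (neg_sgraph \<Gamma>) H"
proof -
  have "- sigma H (f ` e) = sigma \<Gamma> e \<longleftrightarrow> sigma H (f ` e) = - sigma \<Gamma> e" for f :: "'a \<Rightarrow> 'b" and e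
    by auto
  then show ?thesis by (simp add: sgraph_iso_def neg_sgraph_def)
qed

text \<open>The off-diagonal part of L = -s x x^T. The sign classes of \<open>x\<close> are the two
  copies of the complete graph; \<open>s = 1\<close> belongs to the join and \<open>s = -1\<close>
  to its negative.\<close>

definition balanced_signing :: "'a sgraph \<Rightarrow> ('a \<Rightarrow> real) \<Rightarrow> real \<Rightarrow> bool" where
  "balanced_signing \<Gamma> x s \<longleftrightarrow>
     (\<forall>v\<in>verts \<Gamma>. x v = 1 \<or> x v = -1) \<and> (\<Sum>v\<in>verts \<Gamma>. x v) = 0 \<and>
     (\<forall>u\<in>verts \<Gamma>. \<forall>v\<in>verts \<Gamma>. u \<noteq> v \<longrightarrow>
        {u, v} \<in> edges \<Gamma> \<and> real_of_int (sigma \<Gamma> {u, v}) = s * x u * x v)"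

lemma balanced_signing_neg: "balanced_signing (neg_sgraph \<Gamma>) x s \<longleftrightarrow> balanced_signing \<Gamma> x (- s)"
  by (auto simp: balanced_signing_def neg_sgraph_def minus_equation_iff)

text \<open>The signing is pulled back from the value 1 on the left copy and -1 on the right copy;
  it is balanced because the copies have equal size.\<close>

lemma sgraph_iso_neg_join_imp_signing:
  fixes \<Gamma> :: "'a sgraph"
  assumes edges_subset: "\<And>e. e \<in> edges \<Gamma> \<Longrightarrow> e \<subseteq> verts \<Gamma>"
    and iso: "sgraph_iso \<Gamma> (neg_join (complete_sgraph k) (complete_sgraph k))"
  shows "\<exists>x. balanced_signing \<Gamma> x 1"
proof -
  let ?H = "neg_join (complete_sgraph k) (complete_sgraph k)" and ?W = "{..<k} <+> {..<k}"
  obtain f where f: "bij_betw f (verts \<Gamma>) (verts ?H)" "edges ?H = (\<lambda>e. f ` e) ` edges \<Gamma>"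
    "\<forall>e\<in>edges \<Gamma>. sigma ?H (f ` e) = sigma \<Gamma> e"
    using iso unfolding sgraph_iso_def by (elim exE conjE)
  have bij: "bij_betw f (verts \<Gamma>) ?W" using f(1) unfolding verts_neg_join_complete .
  define h where "h = (\<lambda>a :: nat + nat. if isl a then 1 else - 1 :: real)"
  define x where "x = (\<lambda>v. h (f v))"
  have "(\<Sum>v\<in>verts \<Gamma>. x v) = (\<Sum>a\<in>?W. h a)"
    unfolding x_def by (rule sum.reindex_bij_betw[OF bij])
  also have "\<dots> = 0" by (simp add: sum.Plus h_def)
  finally have "(\<Sum>v\<in>verts \<Gamma>. x v) = 0" .
  moreover have "{u, v} \<in> edges \<Gamma> \<and> real_of_int (sigma \<Gamma> {u, v}) = 1 * x u * x v"
    if uv: "u \<in> verts \<Gamma>" "v \<in> verts \<Gamma>" "u \<noteq> v" for u v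
  proof -
    have fuv: "f u \<in> ?W" "f v \<in> ?W" "f u \<noteq> f v"
      using uv bij by (auto simp: bij_betw_def inj_on_def)
    then have "{f u, f v} \<in> edges ?H" by (auto simp: edges_neg_join_complete)
    then obtain e where e: "e \<in> edges \<Gamma>" "f ` {u, v} = f ` e" using f(2) by auto
    \<comment> \<open>\<open>f\<close> is injective on the vertices only, so \<open>e\<close> must
      be known to consist of vertices before the images can be cancelled.\<close>
    have "{u, v} = e"
      using e edges_subset[OF e(1)] uv inj_on_image_eq_iff[OF bij_betw_imp_inj_on[OF bij], of "{u, v}" e]
      by auto
    then have "{u, v} \<in> edges \<Gamma>" using e by simp
    moreover have "sigma ?H (f ` {u, v}) = sigma \<Gamma> {u, v}" using f(3) calculation by blast
    then have "sigma \<Gamma> {u, v} = (if isl (f u) = isl (f v) then 1 else -1)"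
      by (simp add: sigma_neg_join_complete)
    ultimately show ?thesis by (auto simp: x_def h_def)
  qed
  ultimately have "balanced_signing \<Gamma> x 1" by (auto simp: balanced_signing_def x_def h_def)
  then show ?thesis by blast
qed

text \<open>Balance makes the two sign classes equally large. Numbering each of them separately maps
  one class to the left copy and the other to the right copy.\<close>

lemma signing_imp_sgraph_iso_neg_join:
  fixes \<Gamma> :: "'a sgraph"
  assumes fin: "finite (verts \<Gamma>)" and edges: "\<And>e. e \<in> edges \<Gamma> \<Longrightarrow> e \<subseteq> verts \<Gamma> \<and> card e = 2"
    and signing: "balanced_signing \<Gamma> x 1"
  shows "even (card (verts \<Gamma>)) \<and>
    sgraph_iso \<Gamma> (neg_join (complete_sgraph (card (verts \<Gamma>) div 2)) (complete_sgraph (card (verts \<Gamma>) div 2)))"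
proof -
  define V where "V = verts \<Gamma>"
  define P where "P = {v \<in> V. x v = 1}"
  define N where "N = {v \<in> V. x v = -1}"
  have x: "\<And>v. v \<in> V \<Longrightarrow> x v = 1 \<or> x v = -1" and sum0: "(\<Sum>v\<in>V. x v) = 0"
    and adj: "\<And>u v. u \<in> V \<Longrightarrow> v \<in> V \<Longrightarrow> u \<noteq> v \<Longrightarrow> {u, v} \<in> edges \<Gamma> \<and> real_of_int (sigma \<Gamma> {u, v}) = x u * x v"
    using signing by (auto simp: balanced_signing_def V_def)
  have V: "V = P \<union> N" "P \<inter> N = {}" and finPN: "finite P" "finite N"
    using x fin by (auto simp: P_def N_def V_def)
  have "(\<Sum>v\<in>V. x v) = (\<Sum>v\<in>P. x v) + (\<Sum>v\<in>N. x v)"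
    using finPN V by (simp add: sum.union_disjoint)
  also have "\<dots> = real (card P) - real (card N)" by (simp add: P_def N_def)
  finally have card_eq: "card P = card N" using sum0 by simp
  have card_V: "card V = card P + card N" using V finPN by (simp add: card_Un_disjoint)
  define k where "k = card P"
  have k: "card V div 2 = k" and even_V: "even (card V)" using card_V card_eq k_def by auto
  have "card P = card {..<k}" "card N = card {..<k}" using card_eq by (simp_all add: k_def)
  then obtain p q where p: "bij_betw p P {..<k}" and q: "bij_betw q N {..<k}"
    using finite_same_card_bij[OF finPN(1) finite_lessThan] finite_same_card_bij[OF finPN(2) finite_lessThan]
    by meson
  let ?H = "neg_join (complete_sgraph k) (complete_sgraph k)" and ?W = "{..<k} <+> {..<k}"
  define f where "f v = (if x v = 1 then Inl (p v) else Inr (q v))" for v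
  have "bij_betw f P (Inl ` {..<k})"
  proof -
    have "bij_betw (Inl \<circ> p) P (Inl ` {..<k})"
      by (rule bij_betw_trans[OF p]) (simp add: bij_betw_def)
    moreover have "f v = (Inl \<circ> p) v" if "v \<in> P" for v using that by (simp add: f_def P_def)
    ultimately show ?thesis using bij_betw_cong[of P f "Inl \<circ> p"] by blast
  qed
  moreover have "bij_betw f N (Inr ` {..<k})"
  proof -
    have "bij_betw (Inr \<circ> q) N (Inr ` {..<k})"
      by (rule bij_betw_trans[OF q]) (simp add: bij_betw_def)
    moreover have "f v = (Inr \<circ> q) v" if "v \<in> N" for v using that by (simp add: f_def N_def)
    ultimately show ?thesis using bij_betw_cong[of N f "Inr \<circ> q"] by blast
  qed
  ultimately have "bij_betw f (P \<union> N) (Inl ` {..<k} \<union> Inr ` {..<k})"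
    by (rule bij_betw_combine) auto
  then have bij: "bij_betw f V ?W" using V(1) by (simp add: Plus_def)
  have E: "edges \<Gamma> = {e. e \<subseteq> V \<and> card e = 2}"
    using edges adj by (auto simp: V_def card_2_iff)
  have "sgraph_iso \<Gamma> ?H"
    unfolding sgraph_iso_def
  proof (intro exI[of _ f] conjI ballI)
    show "bij_betw f (verts \<Gamma>) (verts ?H)" using bij by (simp add: V_def verts_neg_join_complete)
    show "edges ?H = (`) f ` edges \<Gamma>"
      unfolding E image_two_subsets[OF bij] by (rule edges_neg_join_complete)
    fix e assume "e \<in> edges \<Gamma>"
    then obtain u v where e: "e = {u, v}" "u \<noteq> v" "u \<in> V" "v \<in> V" by (auto simp: E card_2_iff)
    have "sigma ?H (f ` e) = (if isl (f u) = isl (f v) then 1 else -1)"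
      by (simp add: e sigma_neg_join_complete)
    moreover have "real_of_int (sigma \<Gamma> e) = (if isl (f u) = isl (f v) then 1 else -1)"
      using adj[of u v] x[of u] x[of v] e by (auto simp: f_def)
    then have "sigma \<Gamma> e = (if isl (f u) = isl (f v) then 1 else -1)"
      by (auto split: if_splits)
    ultimately show "sigma ?H (f ` e) = sigma \<Gamma> e" by simp
  qed
  then show ?thesis using k even_V by (simp add: V_def)
qed

lemma sgraph_iso_neg_join_iff:
  assumes "signed_graph \<Gamma>"
  shows "even (card (verts \<Gamma>)) \<and> sgraph_iso \<Gamma>
      (neg_join (complete_sgraph (card (verts \<Gamma>) div 2)) (complete_sgraph (card (verts \<Gamma>) div 2)))
    \<longleftrightarrow> (\<exists>x. balanced_signing \<Gamma> x 1)"
proof -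
  have "finite (verts \<Gamma>)" "\<And>e. e \<in> edges \<Gamma> \<Longrightarrow> e \<subseteq> verts \<Gamma> \<and> card e = 2"
    using assms by (auto simp: signed_graph_def)
  then show ?thesis
    using sgraph_iso_neg_join_imp_signing[of \<Gamma>] signing_imp_sgraph_iso_neg_join[of \<Gamma>] by metis
qed

section \<open>Net Laplacians of rank one\<close>

context conn_signed_graph
begin

lemma lap_commute: "lap u v = lap v u"
  by (simp add: lap_eq_sum algebra_simps)

lemma lap_row_sum: "(\<Sum>v\<in>V. lap u v) = 0"
proof -
  have "(\<Sum>v\<in>V. lap u v * 1) = bdry (twist (grad (\<lambda>_. 1))) u" by (rule lap_apply)
  also have "\<dots> = 0" by (simp add: bdry_def twist_def grad_def)
  finally show ?thesis by simp
qed

lemma lap_delta: "u \<in> V \<Longrightarrow> (\<Sum>v\<in>V. lap w v * delta u v) = lap w u"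
proof -
  assume "u \<in> V"
  have "(\<Sum>v\<in>V. lap w v * delta u v) = (\<Sum>v\<in>V. if v = u then lap w u else 0)"
    by (intro sum.cong) (auto simp: delta_def)
  then show ?thesis using \<open>u \<in> V\<close> finite_V by simp
qed

text \<open>The first edge of a walk to another vertex; it shows that no column of the net Laplacian
  is zero.\<close>

lemma neighbour_exists:
  assumes "u \<in> V" "2 \<le> card V"
  shows "\<exists>w\<in>V. {u, w} \<in> E \<and> w \<noteq> u \<and> lap w u \<noteq> 0"
proof -
  have "V \<noteq> {u}" using assms(2) by auto
  then obtain v where v: "v \<in> V" "v \<noteq> u" using assms(1) by blast
  have "(u, v) \<in> {(x, y). {x, y} \<in> E}\<^sup>*"
    using assms v connected by (simp add: connected_sgraph_def)
  then obtain w where w: "{u, w} \<in> E" using v by (cases rule: converse_rtranclE) auto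
  have "w \<in> V" "w \<noteq> u" using edge_subset[OF w] edge_ne[OF w] by auto
  moreover have "lap u w \<noteq> 0" using w sigma_cases[OF w] edge_ne[OF w] by (auto simp: lap_def)
  ultimately show ?thesis using w lap_commute[of u w] by auto
qed

lemma delta_notin_lap_kernel:
  assumes "u \<in> V" "2 \<le> card V"
  shows "delta u \<notin> lap_kernel"
  using neighbour_exists[OF assms] lap_delta[OF assms(1)] by (auto simp: mat_fun_kernel_def)

lemma dim_lap_kernel_less:
  assumes "2 \<le> card V"
  shows "fs.dim lap_kernel < card V"
proof -
  obtain u where u: "u \<in> V" using V_nonempty by blast
  have "lap_kernel \<subseteq> supported V" by (auto simp: mat_fun_kernel_def)
  then have "lap_kernel \<subset> supported V"
    using delta_notin_lap_kernel[OF u assms] delta_in_supported[OF u] by blast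
  then have "fs.dim lap_kernel < fs.dim (supported V)"
    using finite_V by (intro fs.subspace_dim_psubset[OF subspace_mat_fun_kernel _ supported_subset_span]) auto
  then show ?thesis using dim_supported[OF finite_V] by simp
qed

text \<open>The kernel has codimension one and misses \<open>delta u\<close>. So
  \<open>delta v\<close> is a kernel vector plus a multiple of \<open>delta u\<close>, and applying
  the matrix compares the two columns.\<close>

lemma lap_columns_proportional:
  assumes dim: "Suc (fs.dim lap_kernel) = card V" and n: "2 \<le> card V" and uv: "u \<in> V" "v \<in> V"
  shows "\<exists>k. \<forall>w\<in>V. lap w v = k * lap w u"
proof -
  obtain C where C: "C \<subseteq> lap_kernel" "fs.independent C" "lap_kernel \<subseteq> fs.span C" "card C = fs.dim lap_kernel"
    using fs.basis_exists by blast
  have spanC: "fs.span C = lap_kernel"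
    using C(1,3) subspace_mat_fun_kernel by (rule fs.span_subspace)
  have du: "delta u \<notin> fs.span C" using delta_notin_lap_kernel[OF uv(1) n] spanC by simp
  define D where "D = insert (delta u) C"
  have indD: "fs.independent D"
    unfolding D_def using du C(2) by (rule fs.independent_insertI)
  have KS: "lap_kernel \<subseteq> supported V" by (auto simp: mat_fun_kernel_def)
  have DS: "D \<subseteq> supported V" using C(1) KS delta_in_supported[OF uv(1)] by (auto simp: D_def)
  have finD: "finite D"
    using fs.independent_span_bound[OF _ indD, of "delta ` V"] DS finite_V supported_subset_span[OF finite_V]
    by blast
  have "card D = Suc (card C)"
    unfolding D_def using finD du fs.span_base[of "delta u" C]
    by (intro card_insert_disjoint) (auto simp: D_def)
  then have cardD: "card D = card V" using C(4) dim by simp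
  have span_sub: "fs.span D \<subseteq> supported V" using DS by (intro fs.span_minimal subspace_supported)
  have "fs.span D = supported V"
  proof (rule ccontr)
    assume "fs.span D \<noteq> supported V"
    then have "fs.span D \<subset> supported V" using span_sub by blast
    then have "fs.dim (fs.span D) < fs.dim (supported V)"
      using finite_V by (intro fs.subspace_dim_psubset[OF fs.subspace_span _ supported_subset_span]) auto
    then show False
      using cardD dim_supported[OF finite_V] fs.dim_span_eq_card_independent[OF indD] by simp
  qed
  then have "delta v \<in> fs.span (insert (delta u) C)" using delta_in_supported[OF uv(2)] D_def by blast
  then obtain k where "delta v - fscale k (delta u) \<in> lap_kernel"
    unfolding fs.span_breakdown_eq spanC by blast
  then have k: "\<forall>w\<in>V. (\<Sum>z\<in>V. lap w z * (delta v - fscale k (delta u)) z) = 0"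
    by (simp add: mat_fun_kernel_def)
  have "lap w v = k * lap w u" if "w \<in> V" for w
  proof -
    have "(\<Sum>z\<in>V. lap w z * (delta v - fscale k (delta u)) z)
        = (\<Sum>z\<in>V. lap w z * delta v z) - k * (\<Sum>z\<in>V. lap w z * delta u z)"
      by (simp add: sum_distrib_left sum_subtractf algebra_simps)
    then show ?thesis using k that lap_delta[OF uv(1)] lap_delta[OF uv(2)] by simp
  qed
  then show ?thesis by blast
qed

lemma signing_imp_dim_lap_kernel:
  assumes s: "s = 1 \<or> s = -1" and signing: "balanced_signing \<Gamma> x s"
  shows "Suc (fs.dim lap_kernel) = card V"
proof -
  have x: "\<And>v. v \<in> V \<Longrightarrow> x v = 1 \<or> x v = -1" and sum0: "(\<Sum>v\<in>V. x v) = 0"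
    and adj: "\<And>u v. u \<in> V \<Longrightarrow> v \<in> V \<Longrightarrow> u \<noteq> v \<Longrightarrow> {u, v} \<in> E \<and> sg {u, v} = s * x u * x v"
    using signing by (auto simp: balanced_signing_def)
  have off: "lap u v = - s * x u * x v" if "u \<in> V" "v \<in> V" "u \<noteq> v" for u v
    using adj[OF that] that by (simp add: lap_def)
  \<comment> \<open>The row sum is 0 and the other values of \<open>x\<close> add up to
    \<open>- x u\<close>, so the diagonal entry follows the same formula as the rest.\<close>
  have diag: "lap u u = - s * x u * x u" if u: "u \<in> V" for u
  proof -
    have "0 = lap u u + (\<Sum>v\<in>V - {u}. lap u v)"
      using lap_row_sum[of u] u finite_V by (simp add: sum.remove)
    also have "(\<Sum>v\<in>V - {u}. lap u v) = (\<Sum>v\<in>V - {u}. - s * x u * x v)"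
      using off u by (intro sum.cong) auto
    also have "\<dots> = - s * x u * (\<Sum>v\<in>V - {u}. x v)" by (simp add: sum_distrib_left)
    also have "(\<Sum>v\<in>V - {u}. x v) = - x u"
      using sum0 u finite_V by (simp add: sum.remove)
    finally show ?thesis by simp
  qed
  have lap: "lap u v = - s * x u * x v" if "u \<in> V" "v \<in> V" for u v
    using off diag that by (cases "u = v") auto
  have "(\<Sum>v\<in>V. lap u v * y v) = - s * x u * (\<Sum>v\<in>V. x v * y v)" if "u \<in> V" for u y
    using that by (simp add: lap sum_distrib_left mult.assoc)
  moreover have "- s * x u \<noteq> 0" if "u \<in> V" for u using x[OF that] s by auto
  ultimately have "lap_kernel = {y \<in> supported V. (\<Sum>v\<in>V. x v * y v) = 0}"
    using V_nonempty by (auto simp: mat_fun_kernel_def)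
  moreover obtain r where r: "r \<in> V" using V_nonempty by blast
  have "x r \<noteq> 0" using x[OF r] by auto
  ultimately show ?thesis using dim_hyperplane[of V r x] r finite_V by simp
qed

lemma dim_lap_kernel_imp_signing:
  assumes dim: "Suc (fs.dim lap_kernel) = card V" and n: "2 \<le> card V"
  shows "\<exists>s x. (s = 1 \<or> s = -1) \<and> balanced_signing \<Gamma> x s"
proof -
  note cols = lap_columns_proportional[OF dim n]
  \<comment> \<open>A zero on the diagonal would make the factor between column \<open>u\<close> and
    the column of a neighbour 0, and with it the whole column \<open>u\<close>.\<close>
  have diag: "lap u u \<noteq> 0" if u: "u \<in> V" for u
  proof
    assume z: "lap u u = 0"
    obtain w where w: "w \<in> V" "lap w u \<noteq> 0" using neighbour_exists[OF u n] by blast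
    obtain k where k: "\<forall>y\<in>V. lap y u = k * lap y w" using cols[OF w(1) u] by blast
    then have "k = 0" using z u w lap_commute[of u w] by auto
    then show False using k w by auto
  qed
  have nz: "lap v u \<noteq> 0" if uv: "u \<in> V" "v \<in> V" for u v
  proof -
    obtain k where "\<forall>y\<in>V. lap y v = k * lap y u" using cols[OF uv] by blast
    then show ?thesis using diag[OF uv(2)] uv by auto
  qed
  have off: "{u, v} \<in> E \<and> lap u v = - sg {u, v}" if "u \<in> V" "v \<in> V" "u \<noteq> v" for u v
    using nz[of v u] that by (auto simp: lap_def split: if_splits)
  have off_sq: "lap u v * lap u v = 1" if "u \<in> V" "v \<in> V" "u \<noteq> v" for u v
    using off[OF that] sg_sq[of "{u, v}"] by simp
  \<comment> \<open>The vanishing 2x2 minor on \<open>u\<close> and \<open>v\<close> makes the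
    product of two net-degrees 1, and these are integers.\<close>
  have diag_unit: "lap u u = 1 \<or> lap u u = -1" if u: "u \<in> V" for u
  proof -
    obtain v where v: "v \<in> V" "v \<noteq> u" using neighbour_exists[OF u n] by blast
    obtain k where k: "\<forall>y\<in>V. lap y v = k * lap y u" using cols[OF u v(1)] by blast
    have "lap u u * lap v v = lap u v * lap u v"
      using k u v lap_commute[of u v] by (simp add: algebra_simps)
    then have "lap u u * lap v v = 1" using off_sq[of u v] u v by simp
    moreover have di: "lap w w = real_of_int (net_degree \<Gamma> w)" for w
      using edge_ne[of w w] by (auto simp: lap_def)
    ultimately have "real_of_int (net_degree \<Gamma> u * net_degree \<Gamma> v) = real_of_int 1" by simp
    then have "net_degree \<Gamma> u * net_degree \<Gamma> v = 1" by (simp only: of_int_eq_iff)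
    then have "net_degree \<Gamma> u = 1 \<or> net_degree \<Gamma> u = -1" by (auto simp: zmult_eq_1_iff)
    then show ?thesis using di[of u] by auto
  qed
  obtain r where r: "r \<in> V" using V_nonempty by blast
  define x where "x = lap r"
  \<comment> \<open>The minus sign reflects that off-diagonal entries of the net Laplacian are
    negated edge signs.\<close>
  define s where "s = - lap r r"
  have s: "s = 1 \<or> s = -1" using diag_unit[OF r] by (auto simp: s_def)
  \<comment> \<open>Rank one gives L_uv L_rr = L_ur L_rv, and \<open>lap r r\<close> is its own
    inverse.\<close>
  have lap: "lap u v = lap r r * x u * x v" if uv: "u \<in> V" "v \<in> V" for u v
  proof -
    obtain k where k: "\<forall>y\<in>V. lap y v = k * lap y r" using cols[OF r uv(2)] by blast
    have "lap r r * x u * x v = (lap r r * lap r r) * (k * lap u r)"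
      using k r lap_commute[of r u] by (simp add: x_def algebra_simps)
    also have "\<dots> = lap u v" using k uv diag_unit[OF r] by auto
    finally show ?thesis by simp
  qed
  have "x v = 1 \<or> x v = -1" if v: "v \<in> V" for v
  proof (cases "v = r")
    case True
    then show ?thesis using diag_unit[OF r] by (simp add: x_def)
  next
    case False
    then show ?thesis using off_sq[of r v] r v by (simp add: x_def square_eq_1_iff)
  qed
  moreover have "(\<Sum>v\<in>V. x v) = 0" unfolding x_def by (rule lap_row_sum)
  moreover have "{u, v} \<in> E \<and> sg {u, v} = s * x u * x v" if "u \<in> V" "v \<in> V" "u \<noteq> v" for u v
    using off[OF that] lap[OF that(1,2)] by (simp add: s_def)
  ultimately have "balanced_signing \<Gamma> x s" by (auto simp: balanced_signing_def)
  then show ?thesis using s by blast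
qed

end

theorem theorem1p2:
  fixes \<Gamma> :: "'a sgraph" and n :: nat and vs :: "'a list"
  assumes "signed_graph \<Gamma>"
    and "connected_sgraph \<Gamma>"
    and "n = card (verts \<Gamma>)"
    and "n \<ge> 2"
    and "vertex_enum \<Gamma> vs"
  shows "(1 \<le> nullity \<Gamma> vs \<and>
           int (nullity \<Gamma> vs) \<le> min (cyclomatic \<Gamma> + 1) (int n - 1)) \<and>
         (nullity \<Gamma> vs = n - 1 \<longleftrightarrow>
           even n \<and>
           (sgraph_iso \<Gamma> (neg_join (complete_sgraph (n div 2)) (complete_sgraph (n div 2))) \<or>
            sgraph_iso \<Gamma> (neg_sgraph (neg_join (complete_sgraph (n div 2)) (complete_sgraph (n div 2)))))) \<and>
         (signed_cactus \<Gamma> \<longrightarrow>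
           (nullity \<Gamma> vs = 1 \<longleftrightarrow> (\<forall>C\<in>cycles \<Gamma>. m_pos \<Gamma> C \<noteq> m_neg \<Gamma> C)) \<and>
           (int (nullity \<Gamma> vs) = cyclomatic \<Gamma> + 1 \<longleftrightarrow> (\<forall>C\<in>cycles \<Gamma>. m_pos \<Gamma> C = m_neg \<Gamma> C)))"
proof -
  interpret conn_signed_graph \<Gamma> by unfold_locales fact+
  have n2: "2 \<le> card V" using assms(3,4) by simp
  have nullity: "nullity \<Gamma> vs = fs.dim lap_kernel" by (rule nullity_eq_dim) fact
  then have nullity': "nullity \<Gamma> vs = 1 + fs.dim sform_radical" using dim_lap_kernel by simp
  have "int (nullity \<Gamma> vs) \<le> int n - 1"
    using dim_lap_kernel_less[OF n2] nullity assms(3) by linarith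
  moreover have "int (nullity \<Gamma> vs) \<le> cyclomatic \<Gamma> + 1"
    using nullity' dim_radical_le dim_flows_cyclomatic by linarith
  ultimately have i: "1 \<le> nullity \<Gamma> vs \<and> int (nullity \<Gamma> vs) \<le> min (cyclomatic \<Gamma> + 1) (int n - 1)"
    using nullity' by simp
  let ?J = "neg_join (complete_sgraph (n div 2)) (complete_sgraph (n div 2))"
  \<comment> \<open>The case \<open>s = -1\<close> is the case \<open>s = 1\<close> for the graph
    with all signs reversed.\<close>
  have "signed_graph (neg_sgraph \<Gamma>)"
    using assms(1) by (auto simp: signed_graph_def neg_sgraph_def)
  from sgraph_iso_neg_join_iff[OF this]
  have minus: "even n \<and> sgraph_iso \<Gamma> (neg_sgraph ?J) \<longleftrightarrow> (\<exists>x. balanced_signing \<Gamma> x (-1))"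
    by (simp add: sgraph_iso_neg_iff balanced_signing_neg assms(3))
  have plus: "even n \<and> sgraph_iso \<Gamma> ?J \<longleftrightarrow> (\<exists>x. balanced_signing \<Gamma> x 1)"
    using sgraph_iso_neg_join_iff[OF assms(1)] assms(3) by simp
  have "nullity \<Gamma> vs = n - 1 \<longleftrightarrow> Suc (fs.dim lap_kernel) = card V"
    using nullity assms(3,4) by auto
  also have "\<dots> \<longleftrightarrow> (\<exists>s x. (s = 1 \<or> s = -1) \<and> balanced_signing \<Gamma> x s)"
    using signing_imp_dim_lap_kernel dim_lap_kernel_imp_signing[OF _ n2] by blast
  also have "\<dots> \<longleftrightarrow> even n \<and> (sgraph_iso \<Gamma> ?J \<or> sgraph_iso \<Gamma> (neg_sgraph ?J))"
    using plus minus by blast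
  finally have ii: "nullity \<Gamma> vs = n - 1 \<longleftrightarrow> even n \<and> (sgraph_iso \<Gamma> ?J \<or> sgraph_iso \<Gamma> (neg_sgraph ?J))" .
  have "nullity \<Gamma> vs = 1 \<longleftrightarrow> (\<forall>C\<in>cycles \<Gamma>. m_pos \<Gamma> C \<noteq> m_neg \<Gamma> C)" if "signed_cactus \<Gamma>"
    using nullity' dim_radical_eq_0_iff radical_trivial_iff[OF that] by simp
  moreover have "int (nullity \<Gamma> vs) = cyclomatic \<Gamma> + 1 \<longleftrightarrow> (\<forall>C\<in>cycles \<Gamma>. m_pos \<Gamma> C = m_neg \<Gamma> C)"
    if "signed_cactus \<Gamma>"
  proof -
    have "int (nullity \<Gamma> vs) = cyclomatic \<Gamma> + 1 \<longleftrightarrow> fs.dim sform_radical = fs.dim flows"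
      using nullity' dim_flows_cyclomatic by linarith
    then show ?thesis using dim_radical_eq_flows_iff radical_full_iff[OF that] by simp
  qed
  ultimately show ?thesis using i ii by blast
qed

end
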